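(* Let $H$ be a real Hilbert space and let $B\subset H\setminus\{0\}$ be connected in the weak topology of $H$ and such that the closed linear span of $B$ equals $H$. Let $\Phi:B\to H$ be continuous with respect to the weak topology and such that for any $n\in\mathbb{N}$ and any distinct $v_{1},\dots,v_{n}\in B$ the parallelepipeds $P(v_{1},\dots,v_{n})$ and $P(\Phi(v_{1}),\dots,\Phi(v_{n}))$ have the same ($n$-dimensional) volume. Then there is an isometry $T$ on $H$ such that $T|_{B}=\Phi$.
   Context: For a family of vectors $v_{1},\dots,v_{n}$ in a real Hilbert space $H$, $P(v_{1},\dots,v_{n})=\{\sum_{i=1}^{n}\alpha_{i}v_{i}:\alpha_{i}\in[0,1]\}$ if the family is linearly independent, and $P(v_{1},\dots,v_{n})=\{0\}$ if the family is linearly dependent (in particular if two of the vectors coincide). Its volume $V(v_{1},\dots,v_{n})$ is the $n$-dimensional Hausdorff measure, so that $V(v_{1},\dots,v_{n})^{2}=\det[\langle v_{i},v_{j}\rangle]_{i,j=1}^{n}$ (which is $0$ in the dependent case). Continuity of $\Phi$ is with the weak topology on both $B$ (the subspace topology) and the target $H$. An isometry on $H$ is a linear isometric operator $T:H\to H$, not necessarily surjective. *)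

theory Defs
  imports "HOL-Analysis.Analysis"
begin

definition weak_topology :: "'a::real_normed_vector topology" where
  "weak_topology =
     topology_generated_by {f -` U | (f :: 'a \<Rightarrow> real) U. bounded_linear f \<and> open U}"

definition linearly_independent_family :: "nat \<Rightarrow> (nat \<Rightarrow> 'a::real_vector) \<Rightarrow> bool" where
  "linearly_independent_family n v \<longleftrightarrow>
     inj_on v {..<n} \<and> independent (v ` {..<n})"

text \<open>The family \<open>v\<^sub>1, \<dots>, v\<^sub>n\<close> is given by the values \<open>v 0, \<dots>, v (n - 1)\<close>;
  the values of \<open>v\<close> at other arguments are irrelevant.\<close>

definition parallelepiped :: "nat \<Rightarrow> (nat \<Rightarrow> 'a::real_vector) \<Rightarrow> 'a set" where
  "parallelepiped n v =
     (if linearly_independent_family n v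
      then {(\<Sum>i<n. \<alpha> i *\<^sub>R v i) | \<alpha> :: nat \<Rightarrow> real. \<forall>i<n. \<alpha> i \<in> {0..1}}
      else {0})"

text \<open>The \<open>n\<close>-dimensional Hausdorff measure, as an outer measure on all subsets. The factor
  \<open>unit_ball_vol n / 2 ^ n\<close> is the usual normalisation, under which it agrees with Lebesgue
  measure on an \<open>n\<close>-dimensional Euclidean space. Covering sets are required to be bounded because
  \<^const>\<open>diameter\<close> is not meaningful for unbounded sets, and empty covering sets get weight \<open>0\<close>
  explicitly because \<open>0 ^ 0 = 1\<close> (which matters only for \<open>n = 0\<close>).\<close>

definition hausdorff_weight :: "nat \<Rightarrow> 'a::metric_space set \<Rightarrow> ennreal" where
  "hausdorff_weight n U =
     (if U = {} then 0 else ennreal (unit_ball_vol (real n) * (diameter U / 2) ^ n))"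

definition hausdorff_premeasure :: "nat \<Rightarrow> real \<Rightarrow> 'a::metric_space set \<Rightarrow> ennreal" where
  "hausdorff_premeasure n \<delta> A =
     Inf {(\<Sum>i. hausdorff_weight n (U i)) | U :: nat \<Rightarrow> 'a set.
            A \<subseteq> (\<Union>i. U i) \<and> (\<forall>i. bounded (U i) \<and> diameter (U i) \<le> \<delta>)}"

definition hausdorff_measure :: "nat \<Rightarrow> 'a::metric_space set \<Rightarrow> ennreal" where
  "hausdorff_measure n A = (SUP \<delta>\<in>{0<..}. hausdorff_premeasure n \<delta> A)"

definition parallelepiped_volume :: "nat \<Rightarrow> (nat \<Rightarrow> 'a::real_normed_vector) \<Rightarrow> ennreal" where
  "parallelepiped_volume n v = hausdorff_measure n (parallelepiped n v)"

definition linear_isometry :: "('a::real_normed_vector \<Rightarrow> 'a) \<Rightarrow> bool" where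
  "linear_isometry T \<longleftrightarrow> linear T \<and> (\<forall>x. norm (T x) = norm x)"

end

theory Submission
  imports Defs "Jordan_Normal_Form.Determinant"
begin

text \<open>Let \<open>G(v)\<close> be the Gram determinant. The Hausdorff measure of a parallelepiped is
  \<open>c\<^sub>n \<surd>G(v)\<close> with \<open>0 < c\<^sub>n < \<infinity>\<close>: both sides are unchanged by shears \<open>v\<^sub>j \<mapsto> v\<^sub>j + t v\<^sub>i\<close> and scale alike, so
  Gram--Schmidt reduces the claim to orthonormal families, which are all isometric. (Only
  \<open>0 < c\<^sub>n < \<infinity>\<close> is needed, so the isodiametric inequality, which gives \<open>c\<^sub>n = 1\<close>, is avoided.)

  Hence \<open>\<Phi>\<close> preserves all Gram determinants, in particular inner products up to sign. By weak
  continuity the sign is \<open>+\<close> for nearby points, and \<open>B\<close> being connected, any two points are joined by a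
  chain with nonzero preserved inner products. If some inner product changed its sign, a pair
  \<open>x, y\<close> of this kind with the shortest chain would give, by minimality, a chordless cycle in the
  graph of nonvanishing inner products, along which exactly one sign flips. The Leibniz
  formula shows that this flip changes the Gram determinant. So \<open>\<Phi>\<close> preserves inner products, and
  the closure of the span of its graph in \<open>H \<times> H\<close> is the graph of the required isometry.\<close>

no_notation Matrix.scalar_prod (infix "\<bullet>" 70)

section \<open>Hausdorff measure\<close>

lemma hausdorff_weight_empty [simp]: "hausdorff_weight n {} = 0"
  by (simp add: hausdorff_weight_def)

section \<open>Weights of covering sets and elementary properties of premeasures\<close>

lemma hausdorff_weight_lipschitz_image:
  assumes "bounded A" "0 < L" "\<And>x y. x \<in> A \<Longrightarrow> y \<in> A \<Longrightarrow> dist (f x) (f y) \<le> L * dist x y"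
  shows "bounded (f ` A)" "diameter (f ` A) \<le> L * diameter A"
    and "hausdorff_weight n (f ` A) \<le> ennreal (L ^ n) * hausdorff_weight n A"
proof -
  have d: "dist (f x) (f y) \<le> L * diameter A" if "x \<in> A" "y \<in> A" for x y
    using assms(3)[OF that] diameter_bounded_bound[OF assms(1) that] assms(2)
    by (meson less_eq_real_def mult_left_mono order_trans)
  show bd: "bounded (f ` A)"
    using d unfolding bounded_two_points by blast
  show diam: "diameter (f ` A) \<le> L * diameter A"
  proof (cases "A = {}")
    case False
    then show ?thesis
      using d unfolding diameter_def[of "f ` A"] by (auto intro!: cSUP_least)
  qed simp
  show "hausdorff_weight n (f ` A) \<le> ennreal (L ^ n) * hausdorff_weight n A"
  proof (cases "A = {}")
    case False
    have "(diameter (f ` A) / 2) ^ n \<le> (L * diameter A / 2) ^ n"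
      using diam diameter_ge_0[OF bd] by (intro power_mono) auto
    then have "unit_ball_vol (real n) * (diameter (f ` A) / 2) ^ n
        \<le> unit_ball_vol (real n) * (L * diameter A / 2) ^ n"
      by (rule mult_left_mono) simp
    also have "\<dots> = L ^ n * (unit_ball_vol (real n) * (diameter A / 2) ^ n)"
      by (simp add: power_mult_distrib power_divide)
    finally have "ennreal (unit_ball_vol (real n) * (diameter (f ` A) / 2) ^ n)
        \<le> ennreal (L ^ n * (unit_ball_vol (real n) * (diameter A / 2) ^ n))"
      by (rule ennreal_leI)
    also have "\<dots> = ennreal (L ^ n) * ennreal (unit_ball_vol (real n) * (diameter A / 2) ^ n)"
      using assms(2) by (intro ennreal_mult') simp
    finally have "ennreal (unit_ball_vol (real n) * (diameter (f ` A) / 2) ^ n)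
        \<le> ennreal (L ^ n) * ennreal (unit_ball_vol (real n) * (diameter A / 2) ^ n)" .
    then show ?thesis using False by (simp add: hausdorff_weight_def)
  qed simp
qed

lemma hausdorff_weight_mono:
  assumes "bounded B" "A \<subseteq> B" "0 < n"
  shows "hausdorff_weight n A \<le> hausdorff_weight n B"
proof (cases "A = {}")
  case False
  have "(diameter A / 2) ^ n \<le> (diameter B / 2) ^ n"
    using diameter_subset[OF assms(2,1)] diameter_ge_0[OF bounded_subset[OF assms(1,2)]]
    by (intro power_mono) auto
  then show ?thesis
    using False assms(2) by (auto simp: hausdorff_weight_def intro!: ennreal_leI mult_left_mono)
qed simp

lemma hausdorff_premeasure_le:
  fixes U :: "nat \<Rightarrow> 'a::metric_space set"
  assumes "A \<subseteq> (\<Union>i. U i)" "\<And>i. bounded (U i)" "\<And>i. diameter (U i) \<le> \<delta>"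
  shows "hausdorff_premeasure n \<delta> A \<le> (\<Sum>i. hausdorff_weight n (U i))"
proof -
  have "(\<Sum>i. hausdorff_weight n (U i)) \<in> {(\<Sum>i. hausdorff_weight n (U i)) | U :: nat \<Rightarrow> 'a set.
      A \<subseteq> (\<Union>i. U i) \<and> (\<forall>i. bounded (U i) \<and> diameter (U i) \<le> \<delta>)}"
    using assms by (intro CollectI exI[of _ U]) simp
  then show ?thesis
    unfolding hausdorff_premeasure_def by (rule Inf_lower)
qed

lemma hausdorff_premeasure_mono: "A \<subseteq> B \<Longrightarrow> hausdorff_premeasure n \<delta> A \<le> hausdorff_premeasure n \<delta> B"
  unfolding hausdorff_premeasure_def by (intro Inf_superset_mono Collect_mono ex_mono) (auto intro: order_trans)

lemma hausdorff_premeasure_antimono: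
  "\<delta> \<le> \<epsilon> \<Longrightarrow> hausdorff_premeasure n \<epsilon> A \<le> hausdorff_premeasure n \<delta> A"
  unfolding hausdorff_premeasure_def by (intro Inf_superset_mono Collect_mono ex_mono) (auto intro: order_trans)

lemma hausdorff_premeasure_le_measure:
  "0 < \<delta> \<Longrightarrow> hausdorff_premeasure n \<delta> A \<le> hausdorff_measure n A"
  unfolding hausdorff_measure_def by (intro SUP_upper) auto

lemma hausdorff_measure_leI:
  "(\<And>\<delta>. 0 < \<delta> \<Longrightarrow> hausdorff_premeasure n \<delta> A \<le> c) \<Longrightarrow> hausdorff_measure n A \<le> c"
  unfolding hausdorff_measure_def by (intro SUP_least) auto

lemma hausdorff_measure_mono: "A \<subseteq> B \<Longrightarrow> hausdorff_measure n A \<le> hausdorff_measure n B"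
  unfolding hausdorff_measure_def by (intro SUP_mono') (rule hausdorff_premeasure_mono)

lemma hausdorff_premeasure_finite_cover_le:
  assumes "finite I" "A \<subseteq> (\<Union>i\<in>I. U i)" "\<And>i. i \<in> I \<Longrightarrow> bounded (U i)"
    and "\<And>i. i \<in> I \<Longrightarrow> diameter (U i) \<le> \<delta>" "0 < \<delta>"
  shows "hausdorff_premeasure n \<delta> A \<le> (\<Sum>i\<in>I. hausdorff_weight n (U i))"
proof -
  obtain h where h: "bij_betw h {0..<card I} I"
    using ex_bij_betw_nat_finite[OF assms(1)] by blast
  \<comment> \<open>Padding with empty sets turns the finite cover into a sequence without changing
    the sum, since empty sets have weight 0.\<close>
  define W where "W k = (if k < card I then U (h k) else {})" for k
  have hI: "h k \<in> I" if "k < card I" for k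
    using h that by (auto simp: bij_betw_def)
  have "(\<Union>i\<in>I. U i) \<subseteq> (\<Union>k. W k)"
  proof
    fix x assume "x \<in> (\<Union>i\<in>I. U i)"
    then obtain i where "i \<in> I" "x \<in> U i" by blast
    moreover have "i \<in> h ` {0..<card I}"
      using \<open>i \<in> I\<close> h by (simp add: bij_betw_def)
    then obtain k where "k < card I" "h k = i" by auto
    ultimately have "x \<in> W k" by (simp add: W_def)
    then show "x \<in> (\<Union>k. W k)" by blast
  qed
  then have "hausdorff_premeasure n \<delta> A \<le> (\<Sum>k. hausdorff_weight n (W k))"
    using assms hI by (intro hausdorff_premeasure_le) (auto simp: W_def)
  also have "\<dots> = (\<Sum>k\<in>{0..<card I}. hausdorff_weight n (W k))"
    by (intro suminf_finite) (auto simp: W_def)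
  also have "\<dots> = (\<Sum>k\<in>{0..<card I}. hausdorff_weight n (U (h k)))"
    by (intro sum.cong) (auto simp: W_def)
  also have "\<dots> = (\<Sum>i\<in>I. hausdorff_weight n (U i))"
    using h by (rule sum.reindex_bij_betw)
  finally show ?thesis .
qed

lemma hausdorff_measure_empty [simp]: "hausdorff_measure n {} = 0"
proof -
  have "hausdorff_measure n {} \<le> 0"
  proof (rule hausdorff_measure_leI)
    fix \<delta> :: real assume "0 < \<delta>"
    then show "hausdorff_premeasure n \<delta> {} \<le> 0"
      using hausdorff_premeasure_finite_cover_le[of "{}" "{}" "\<lambda>_. {}" \<delta> n] by simp
  qed
  then show ?thesis by simp
qed

section \<open>Countable subadditivity\<close>

lemma hausdorff_premeasure_UN:
  fixes A :: "nat \<Rightarrow> 'a::metric_space set"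
  shows "hausdorff_premeasure n \<delta> (\<Union>i. A i) \<le> (\<Sum>i. hausdorff_premeasure n \<delta> (A i))"
proof (cases "(\<Sum>i. hausdorff_premeasure n \<delta> (A i)) = \<infinity>")
  case False
  then have fin: "hausdorff_premeasure n \<delta> (A i) < \<infinity>" for i
    using ennreal_suminf_lessD less_top by auto
  show ?thesis
  proof (rule ennreal_le_epsilon)
    fix e :: real assume e: "0 < e"
    have "\<forall>i. \<exists>U. A i \<subseteq> (\<Union>j. U j) \<and> (\<forall>j. bounded (U j) \<and> diameter (U j) \<le> \<delta>) \<and>
        (\<Sum>j. hausdorff_weight n (U j)) \<le> hausdorff_premeasure n \<delta> (A i) + ennreal (e * (1/2) ^ Suc i)"
    proof
      fix i
      \<comment> \<open>Finiteness makes this strict, and strictness is what yields a cover that is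
        optimal up to a geometrically decreasing error with total e.\<close>
      have "hausdorff_premeasure n \<delta> (A i) < hausdorff_premeasure n \<delta> (A i) + ennreal (e * (1/2) ^ Suc i)"
        using fin[of i] e by (cases "hausdorff_premeasure n \<delta> (A i)") (auto simp flip: ennreal_plus intro!: ennreal_lessI add_nonneg_pos)
      then show "\<exists>U. A i \<subseteq> (\<Union>j. U j) \<and> (\<forall>j. bounded (U j) \<and> diameter (U j) \<le> \<delta>) \<and>
          (\<Sum>j. hausdorff_weight n (U j)) \<le> hausdorff_premeasure n \<delta> (A i) + ennreal (e * (1/2) ^ Suc i)"
        unfolding hausdorff_premeasure_def[of n \<delta> "A i"] Inf_less_iff
        by (auto intro: less_imp_le)
    qed
    from choice[OF this] obtain U where U': "\<forall>i. A i \<subseteq> (\<Union>j. U i j) \<and>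
        (\<forall>j. bounded (U i j) \<and> diameter (U i j) \<le> \<delta>) \<and>
        (\<Sum>j. hausdorff_weight n (U i j)) \<le> hausdorff_premeasure n \<delta> (A i) + ennreal (e * (1/2) ^ Suc i)" ..
    then have U: "\<And>i. A i \<subseteq> (\<Union>j. U i j)" "\<And>i j. bounded (U i j)" "\<And>i j. diameter (U i j) \<le> \<delta>"
        "\<And>i. (\<Sum>j. hausdorff_weight n (U i j)) \<le> hausdorff_premeasure n \<delta> (A i) + ennreal (e * (1/2) ^ Suc i)"
      by blast+
    \<comment> \<open>The double sequence of covering sets is listed as one sequence through the
      pairing bijection on the naturals.\<close>
    define W where "W k = (case prod_decode k of (i, j) \<Rightarrow> U i j)" for k
    have "(\<Union>i. A i) \<subseteq> (\<Union>k. W k)"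
    proof
      fix x assume "x \<in> (\<Union>i. A i)"
      then obtain i j where "x \<in> U i j" using U(1) by blast
      then have "x \<in> W (prod_encode (i, j))" by (simp add: W_def)
      then show "x \<in> (\<Union>k. W k)" by blast
    qed
    then have "hausdorff_premeasure n \<delta> (\<Union>i. A i) \<le> (\<Sum>k. hausdorff_weight n (W k))"
      using U by (intro hausdorff_premeasure_le) (auto simp: W_def split: prod.split)
    also have "\<dots> = (\<Sum>i. \<Sum>j. hausdorff_weight n (U i j))"
      using suminf_ennreal_2dimen[of "\<lambda>i. \<Sum>j. hausdorff_weight n (U i j)"
          "\<lambda>(i, j). hausdorff_weight n (U i j)"]
      by (simp add: W_def split_beta)
    also have "\<dots> \<le> (\<Sum>i. hausdorff_premeasure n \<delta> (A i) + ennreal (e * (1/2) ^ Suc i))"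
      using U(4) by (intro suminf_le) auto
    also have "\<dots> = (\<Sum>i. hausdorff_premeasure n \<delta> (A i)) + (\<Sum>i. ennreal (e * (1/2) ^ Suc i))"
      by (intro suminf_add[symmetric]) auto
    also have "(\<Sum>i. ennreal (e * (1/2) ^ Suc i)) = ennreal e"
      using sums_mult[OF power_half_series, of e] e
      by (intro suminf_ennreal_eq) auto
    finally show "hausdorff_premeasure n \<delta> (\<Union>i. A i) \<le> (\<Sum>i. hausdorff_premeasure n \<delta> (A i)) + ennreal e" .
  qed
qed simp

lemma hausdorff_measure_UN:
  fixes A :: "nat \<Rightarrow> 'a::metric_space set"
  shows "hausdorff_measure n (\<Union>i. A i) \<le> (\<Sum>i. hausdorff_measure n (A i))"
proof (rule hausdorff_measure_leI)
  fix \<delta> :: real assume "0 < \<delta>"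
  then have "(\<Sum>i. hausdorff_premeasure n \<delta> (A i)) \<le> (\<Sum>i. hausdorff_measure n (A i))"
    by (intro suminf_le) (auto intro: hausdorff_premeasure_le_measure)
  then show "hausdorff_premeasure n \<delta> (\<Union>i. A i) \<le> (\<Sum>i. hausdorff_measure n (A i))"
    using hausdorff_premeasure_UN order_trans by blast
qed

lemma hausdorff_measure_Un: "hausdorff_measure n (A \<union> B) \<le> hausdorff_measure n A + hausdorff_measure n B"
proof -
  define F where "F i = (if i = (0::nat) then A else if i = 1 then B else {})" for i
  have "A \<union> B \<subseteq> (\<Union>i. F i)" by (force simp: F_def)
  then have "hausdorff_measure n (A \<union> B) \<le> (\<Sum>i. hausdorff_measure n (F i))"
    using hausdorff_measure_UN[of n F] hausdorff_measure_mono order_trans by blast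
  also have "\<dots> = (\<Sum>i\<in>{0,1}. hausdorff_measure n (F i))"
    by (intro suminf_finite) (auto simp: F_def)
  finally show ?thesis by (simp add: F_def)
qed

section \<open>Lipschitz and isometric images\<close>

lemma hausdorff_measure_lipschitz_image_le:
  fixes f :: "'a::metric_space \<Rightarrow> 'b::metric_space"
  assumes "0 < n" "0 < L" "\<And>x y. x \<in> A \<Longrightarrow> y \<in> A \<Longrightarrow> dist (f x) (f y) \<le> L * dist x y"
  shows "hausdorff_measure n (f ` A) \<le> ennreal (L ^ n) * hausdorff_measure n A"
proof (rule hausdorff_measure_leI)
  fix \<delta> :: real assume \<delta>: "0 < \<delta>"
  have "hausdorff_premeasure n \<delta> (f ` A) \<le> ennreal (L ^ n) * (\<Sum>i. hausdorff_weight n (U i))"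
    if U: "A \<subseteq> (\<Union>i. U i)" "\<forall>i. bounded (U i) \<and> diameter (U i) \<le> \<delta> / L" for U
  proof -
    \<comment> \<open>The covering sets are cut down to A because the Lipschitz bound for f holds
      only there.\<close>
    define W where "W i = U i \<inter> A" for i
    have bW: "bounded (W i)" for i
      using U(2) bounded_subset unfolding W_def by blast
    note * = hausdorff_weight_lipschitz_image[OF bW assms(2)]
    have "diameter (W i) \<le> \<delta> / L" for i
      using U(2) diameter_subset[of "W i" "U i"] unfolding W_def by (metis Int_lower1 order_trans)
    then have **: "L * diameter (W i) \<le> \<delta>" for i
      using assms(2) by (simp add: field_simps)
    have LW: "dist (f x) (f y) \<le> L * dist x y" if "x \<in> W i" "y \<in> W i" for x y i
      using assms(3) that by (simp add: W_def)
    have "f ` A \<subseteq> (\<Union>i. f ` W i)"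
      using U(1) unfolding W_def by blast
    then have "hausdorff_premeasure n \<delta> (f ` A) \<le> (\<Sum>i. hausdorff_weight n (f ` W i))"
    proof (rule hausdorff_premeasure_le)
      show "bounded (f ` W i)" for i
        using *(1) LW by blast
      show "diameter (f ` W i) \<le> \<delta>" for i
        using *(2)[of i f] LW **[of i] by fastforce
    qed
    also have "\<dots> \<le> (\<Sum>i. ennreal (L ^ n) * hausdorff_weight n (U i))"
    proof (rule suminf_le)
      fix i
      have "hausdorff_weight n (W i) \<le> hausdorff_weight n (U i)"
        using U(2) assms(1) by (intro hausdorff_weight_mono) (auto simp: W_def)
      then show "hausdorff_weight n (f ` W i) \<le> ennreal (L ^ n) * hausdorff_weight n (U i)"
        by (intro order_trans[OF *(3)[OF LW] mult_left_mono]) auto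
    qed auto
    finally show ?thesis by simp
  qed
  \<comment> \<open>Dividing by the factor first makes the left side a lower bound of all cover
    sums, hence of their infimum; the factor is then moved back.\<close>
  then have "hausdorff_premeasure n \<delta> (f ` A) / ennreal (L ^ n) \<le> hausdorff_premeasure n (\<delta> / L) A"
    using assms(2) unfolding hausdorff_premeasure_def[of n "\<delta> / L"]
    by (intro Inf_greatest) (auto intro!: divide_le_posI_ennreal)
  then have "ennreal (L ^ n) * (hausdorff_premeasure n \<delta> (f ` A) / ennreal (L ^ n))
      \<le> ennreal (L ^ n) * hausdorff_premeasure n (\<delta> / L) A"
    by (rule mult_left_mono) simp
  then have "hausdorff_premeasure n \<delta> (f ` A) \<le> ennreal (L ^ n) * hausdorff_premeasure n (\<delta> / L) A"
    using assms(2) by (simp add: ennreal_times_divide mult.commute[of "ennreal _"] mult_divide_eq_ennreal)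
  also have "\<dots> \<le> ennreal (L ^ n) * hausdorff_measure n A"
    using \<delta> assms(2) by (intro mult_left_mono hausdorff_premeasure_le_measure) auto
  finally show "hausdorff_premeasure n \<delta> (f ` A) \<le> ennreal (L ^ n) * hausdorff_measure n A" .
qed

text \<open>The Lipschitz estimate with constant 1 applies both to f and to its inverse on the
  image.\<close>

lemma hausdorff_measure_isometric_image:
  fixes f :: "'a::metric_space \<Rightarrow> 'b::metric_space"
  assumes "0 < n" "\<And>x y. x \<in> A \<Longrightarrow> y \<in> A \<Longrightarrow> dist (f x) (f y) = dist x y"
  shows "hausdorff_measure n (f ` A) = hausdorff_measure n A"
proof (rule antisym)
  show "hausdorff_measure n (f ` A) \<le> hausdorff_measure n A"
    using hausdorff_measure_lipschitz_image_le[of n 1 A f] assms by simp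
  have inj: "inj_on f A"
    using assms(2) by (metis inj_onI zero_less_dist_iff less_irrefl)
  have "hausdorff_measure n (inv_into A f ` (f ` A)) \<le> hausdorff_measure n (f ` A)"
  proof -
    have "dist (inv_into A f x) (inv_into A f y) \<le> 1 * dist x y" if "x \<in> f ` A" "y \<in> f ` A" for x y
      using that assms(2) inj by auto
    from hausdorff_measure_lipschitz_image_le[OF assms(1) _ this] show ?thesis by simp
  qed
  then show "hausdorff_measure n A \<le> hausdorff_measure n (f ` A)"
    using inj by (simp add: image_comp)
qed

section \<open>Additivity over separated sets and over level sets of Lipschitz functions\<close>

lemma hausdorff_premeasure_separated:
  assumes "\<And>x y. x \<in> A \<Longrightarrow> y \<in> B \<Longrightarrow> \<delta> < dist x y"
  shows "hausdorff_premeasure n \<delta> A + hausdorff_premeasure n \<delta> B \<le> hausdorff_premeasure n \<delta> (A \<union> B)"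
  unfolding hausdorff_premeasure_def[of n \<delta> "A \<union> B"]
proof (intro Inf_greatest, elim CollectE exE conjE, hypsubst)
  fix U :: "nat \<Rightarrow> 'a set"
  assume AB: "A \<union> B \<subseteq> (\<Union>i. U i)" and U: "\<forall>i. bounded (U i) \<and> diameter (U i) \<le> \<delta>"
  define P where "P C i = (if U i \<inter> C = {} then {} else U i)" for C i
  have \<delta>: "0 \<le> \<delta>"
    using U diameter_ge_0 order_trans by blast
  have le: "hausdorff_premeasure n \<delta> C \<le> (\<Sum>i. hausdorff_weight n (P C i))" if C: "C \<subseteq> A \<union> B" for C
  proof (rule hausdorff_premeasure_le)
    show "C \<subseteq> (\<Union>i. P C i)"
    proof
      fix x assume "x \<in> C"
      then obtain i where "x \<in> U i" using C AB by blast
      then have "x \<in> P C i" using \<open>x \<in> C\<close> by (auto simp: P_def)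
      then show "x \<in> (\<Union>i. P C i)" by blast
    qed
    show "bounded (P C i)" "diameter (P C i) \<le> \<delta>" for i
      using U \<delta> by (auto simp: P_def)
  qed
  \<comment> \<open>A set of diameter at most \<delta> cannot meet both A and B, so each covering
    set is spent on only one of them.\<close>
  have disj: "P A i = {} \<or> P B i = {}" for i
  proof (rule ccontr)
    assume "\<not> ?thesis"
    then obtain x y where xy: "x \<in> A" "y \<in> B" "x \<in> U i" "y \<in> U i"
      by (auto simp: P_def split: if_splits)
    then have "dist x y \<le> \<delta>"
      using U diameter_bounded_bound order_trans by blast
    then show False using assms[OF xy(1,2)] by simp
  qed
  have "hausdorff_premeasure n \<delta> A + hausdorff_premeasure n \<delta> B
      \<le> (\<Sum>i. hausdorff_weight n (P A i)) + (\<Sum>i. hausdorff_weight n (P B i))"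
    by (intro add_mono le) auto
  also have "\<dots> = (\<Sum>i. hausdorff_weight n (P A i) + hausdorff_weight n (P B i))"
    by (rule suminf_add) auto
  also have "\<dots> \<le> (\<Sum>i. hausdorff_weight n (U i))"
  proof (rule suminf_le)
    show "hausdorff_weight n (P A i) + hausdorff_weight n (P B i) \<le> hausdorff_weight n (U i)" for i
      using disj[of i] unfolding P_def by (auto split: if_splits)
  qed auto
  finally show "hausdorff_premeasure n \<delta> A + hausdorff_premeasure n \<delta> B \<le> (\<Sum>i. hausdorff_weight n (U i))" .
qed

lemma hausdorff_measure_separated:
  assumes "0 < r" "\<And>x y. x \<in> A \<Longrightarrow> y \<in> B \<Longrightarrow> r \<le> dist x y"
  shows "hausdorff_measure n A + hausdorff_measure n B \<le> hausdorff_measure n (A \<union> B)"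
proof -
  \<comment> \<open>Premeasures grow as \<delta> shrinks, so the family is directed and the two
    suprema can be taken along a common \<delta>.\<close>
  have "hausdorff_measure n A + hausdorff_measure n B
      = (SUP \<delta>\<in>{0<..}. hausdorff_premeasure n \<delta> A + hausdorff_premeasure n \<delta> B)"
    unfolding hausdorff_measure_def
  proof (rule SUP_add_directed_ennreal[symmetric])
    fix i j :: real assume "i \<in> {0<..}" "j \<in> {0<..}"
    then show "\<exists>k\<in>{0<..}. hausdorff_premeasure n i A + hausdorff_premeasure n j B
        \<le> hausdorff_premeasure n k A + hausdorff_premeasure n k B"
      by (intro bexI[of _ "min i j"] add_mono hausdorff_premeasure_antimono) auto
  qed
  also have "\<dots> \<le> hausdorff_measure n (A \<union> B)"
  proof (rule SUP_least)
    fix \<delta> :: real assume "\<delta> \<in> {0<..}"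
    \<comment> \<open>Half of r is taken because the separation lemma needs distances strictly above
      the mesh.\<close>
    define \<epsilon> where "\<epsilon> = min \<delta> (r / 2)"
    have \<epsilon>: "0 < \<epsilon>" "\<epsilon> \<le> \<delta>" "\<epsilon> < r" using \<open>\<delta> \<in> {0<..}\<close> assms(1) by (auto simp: \<epsilon>_def)
    have "hausdorff_premeasure n \<delta> A + hausdorff_premeasure n \<delta> B
        \<le> hausdorff_premeasure n \<epsilon> A + hausdorff_premeasure n \<epsilon> B"
      using \<epsilon> by (intro add_mono hausdorff_premeasure_antimono) auto
    also have "\<dots> \<le> hausdorff_premeasure n \<epsilon> (A \<union> B)"
      using \<epsilon> assms(2) by (intro hausdorff_premeasure_separated) force
    also have "\<dots> \<le> hausdorff_measure n (A \<union> B)"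
      using \<epsilon> by (intro hausdorff_premeasure_le_measure)
    finally show "hausdorff_premeasure n \<delta> A + hausdorff_premeasure n \<delta> B \<le> hausdorff_measure n (A \<union> B)" .
  qed
  finally show ?thesis .
qed

lemma hausdorff_measure_level_separated:
  fixes f :: "'a::metric_space \<Rightarrow> real"
  assumes "L-lipschitz_on UNIV f" "a < b" "\<And>x. x \<in> A \<Longrightarrow> f x \<le> a" "\<And>x. x \<in> B \<Longrightarrow> b \<le> f x"
  shows "hausdorff_measure n A + hausdorff_measure n B \<le> hausdorff_measure n (A \<union> B)"
proof (rule hausdorff_measure_separated)
  have L: "0 \<le> L" using assms(1) lipschitz_on_nonneg by blast
  \<comment> \<open>Dividing by L + 1 instead of L also covers the Lipschitz constant 0.\<close>
  show "0 < (b - a) / (L + 1)" using assms(2) L by simp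
  fix x y assume "x \<in> A" "y \<in> B"
  then have "b - a \<le> dist (f x) (f y)" using assms(3)[of x] assms(4)[of y] by (simp add: dist_real_def)
  also have "\<dots> \<le> L * dist x y" using lipschitz_onD[OF assms(1)] by simp
  also have "\<dots> \<le> (L + 1) * dist x y" by (intro mult_right_mono) auto
  finally show "(b - a) / (L + 1) \<le> dist x y" using L by (simp add: field_simps)
qed

text \<open>Caratheodory's argument: the layers of \<open>E\<close> that accumulate at the level \<open>c\<close> are pairwise
  separated if every second one is omitted, so their measures have a finite sum and the
  remaining error, a tail of that sum, can be cancelled.\<close>

lemma hausdorff_measure_split_level:
  fixes f :: "'a::metric_space \<Rightarrow> real"
  assumes f: "L-lipschitz_on UNIV f"
  shows "hausdorff_measure n E = hausdorff_measure n {x \<in> E. f x < c} + hausdorff_measure n {x \<in> E. c \<le> f x}"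
proof (rule antisym)
  let ?H = "hausdorff_measure n"
  have "{x \<in> E. f x < c} \<union> {x \<in> E. c \<le> f x} = E" by auto
  then show "?H E \<le> ?H {x \<in> E. f x < c} + ?H {x \<in> E. c \<le> f x}"
    using hausdorff_measure_Un by metis
  show "?H {x \<in> E. f x < c} + ?H {x \<in> E. c \<le> f x} \<le> ?H E"
  proof (cases "?H E = Orderings.top")
    case False
    \<comment> \<open>These levels increase strictly to c without reaching it; the layers
      \<open>R k\<close> lie between consecutive levels.\<close>
    define s where "s k = c - 1 / real (Suc k)" for k
    have s_less: "s i < s j" if "i < j" for i j
      using that by (simp add: s_def frac_less2)
    have s_c: "s i < c" for i by (simp add: s_def)
    define R where "R k = {x \<in> E. s (Suc k) < f x \<and> f x \<le> s (Suc (Suc k))}" for k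
    define A where "A k = {x \<in> E. f x \<le> s (Suc k)}" for k
    \<comment> \<open>The offset b selects the even or the odd layers. Within one parity the skipped
      layer leaves a gap of levels, so separated additivity applies at each step of the
      induction.\<close>
    have "(\<Sum>j<N. ?H (R (2 * j + b))) \<le> ?H {x \<in> E. f x \<le> s (2 * N + b)}" for N b
    proof (induction N)
      case (Suc N)
      have "(\<Sum>j<Suc N. ?H (R (2 * j + b))) \<le> ?H {x \<in> E. f x \<le> s (2 * N + b)} + ?H (R (2 * N + b))"
        using Suc by (simp add: add_right_mono)
      also have "\<dots> \<le> ?H ({x \<in> E. f x \<le> s (2 * N + b)} \<union> R (2 * N + b))"
        by (rule hausdorff_measure_level_separated[OF f s_less[of "2 * N + b" "Suc (2 * N + b)"]])
          (auto simp: R_def)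
      also have "\<dots> \<le> ?H {x \<in> E. f x \<le> s (2 * Suc N + b)}"
        using s_less[of "2 * N + b" "2 * Suc N + b"] by (intro hausdorff_measure_mono) (auto simp: R_def)
      finally show ?case .
    qed simp
    also have "?H {x \<in> E. f x \<le> s k} \<le> ?H E" for k
      by (rule hausdorff_measure_mono) auto
    finally have every_second: "(\<Sum>j<N. ?H (R (2 * j + b))) \<le> ?H E" for N b .
    have "(\<Sum>j<N. ?H (R j)) \<le> ?H E + ?H E" for N
    proof -
      have "(\<Sum>j<N. ?H (R j)) \<le> (\<Sum>j<2 * N. ?H (R j))"
        by (intro sum_mono2) auto
      also have "\<dots> = (\<Sum>j<N. ?H (R (2 * j + 0))) + (\<Sum>j<N. ?H (R (2 * j + 1)))"
        by (induction N) (simp_all add: ac_simps)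
      also have "\<dots> \<le> ?H E + ?H E"
        by (intro add_mono every_second)
      finally show ?thesis .
    qed
    then have "(\<Sum>j. ?H (R j)) \<le> ?H E + ?H E"
      by (intro suminf_le_const) auto
    then have fin: "(\<Sum>j. ?H (R j)) \<noteq> \<infinity>"
      using False by (auto simp: top_unique)
    \<comment> \<open>The part of E below c is covered by \<open>A k\<close> and the layers from
      index k on. Adding the first k layers to both sides completes that tail to the full series,
      and the right-hand bound no longer depends on k.\<close>
    have "(\<Sum>j<k. ?H (R j)) + (?H {x \<in> E. f x < c} + ?H {x \<in> E. c \<le> f x}) \<le> ?H E + (\<Sum>j. ?H (R j))" for k
    proof -
      have "{x \<in> E. f x < c} \<subseteq> A k \<union> (\<Union>j. R (j + k))"
      proof
        fix x assume x: "x \<in> {x \<in> E. f x < c}"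
        then obtain m where "1 / real (Suc m) < c - f x"
          using nat_approx_posE[of "c - f x"] by auto
        then have m: "f x \<le> s m" by (simp add: s_def)
        \<comment> \<open>The first level above f x identifies the layer containing x, unless x
          already lies in \<open>A k\<close>.\<close>
        define l where "l = (LEAST l. f x \<le> s (Suc l))"
        have "f x \<le> s (Suc m)" using m s_less[of m "Suc m"] by simp
        then have l: "f x \<le> s (Suc l)" unfolding l_def by (rule LeastI)
        show "x \<in> A k \<union> (\<Union>j. R (j + k))"
        proof (cases "l \<le> k")
          case True
          then have "s (Suc l) \<le> s (Suc k)" using s_less[of "Suc l" "Suc k"] by (cases "l = k") auto
          then show ?thesis using l x by (simp add: A_def)
        next
          case False
          then obtain j where j: "l = Suc (j + k)" by (metis add.commute add_Suc_right less_imp_Suc_add not_le)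
          then have "\<not> f x \<le> s (Suc (j + k))" using not_less_Least[of "j + k" "\<lambda>l. f x \<le> s (Suc l)"] by (simp add: l_def)
          then have "x \<in> R (j + k)" using l x j by (simp add: R_def)
          then show ?thesis by blast
        qed
      qed
      then have "?H {x \<in> E. f x < c} \<le> ?H (A k \<union> (\<Union>j. R (j + k)))"
        by (rule hausdorff_measure_mono)
      also have "\<dots> \<le> ?H (A k) + ?H (\<Union>j. R (j + k))"
        by (rule hausdorff_measure_Un)
      also have "\<dots> \<le> ?H (A k) + (\<Sum>j. ?H (R (j + k)))"
        by (intro add_left_mono hausdorff_measure_UN)
      finally have "(\<Sum>j<k. ?H (R j)) + (?H {x \<in> E. f x < c} + ?H {x \<in> E. c \<le> f x})
          \<le> (\<Sum>j<k. ?H (R j)) + (?H (A k) + (\<Sum>j. ?H (R (j + k))) + ?H {x \<in> E. c \<le> f x})"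
        by (intro add_mono) auto
      also have "\<dots> = (?H (A k) + ?H {x \<in> E. c \<le> f x}) + (\<Sum>j. ?H (R j))"
        by (subst suminf_offset[of "\<lambda>j. ?H (R j)" k]) (auto simp: ac_simps)
      also have "?H (A k) + ?H {x \<in> E. c \<le> f x} \<le> ?H (A k \<union> {x \<in> E. c \<le> f x})"
        by (rule hausdorff_measure_level_separated[OF f s_c[of "Suc k"]]) (auto simp: A_def)
      also have "\<dots> \<le> ?H E"
        by (rule hausdorff_measure_mono) (auto simp: A_def)
      finally show ?thesis by (simp add: add_right_mono)
    qed
    then have "(\<Sum>j. ?H (R j)) + (?H {x \<in> E. f x < c} + ?H {x \<in> E. c \<le> f x}) \<le> ?H E + (\<Sum>j. ?H (R j))"
      by (rule ennreal_suminf_bound_add)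
    then show ?thesis
      using fin by (simp add: add.commute[of "?H E"] ennreal_add_left_cancel_le)
  qed simp
qed

text \<open>Repeated splitting at the top integer level gives exact additivity over unit slabs,
  which the cut-and-paste argument for shears rearranges.\<close>

lemma hausdorff_measure_slabs:
  fixes f :: "'a::metric_space \<Rightarrow> real"
  assumes f: "L-lipschitz_on UNIV f" and E: "\<And>x. x \<in> E \<Longrightarrow> a \<le> f x \<and> f x < a + real m"
  shows "hausdorff_measure n E = (\<Sum>k<m. hausdorff_measure n {x \<in> E. a + real k \<le> f x \<and> f x < a + real k + 1})"
  using E
proof (induction m arbitrary: E)
  case 0
  then have "E = {}" by fastforce
  then show ?case by simp
next
  case (Suc m)
  let ?H = "hausdorff_measure n" and ?E = "{x \<in> E. f x < a + real m}"
  have "?H E = ?H ?E + ?H {x \<in> E. a + real m \<le> f x}"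
    by (rule hausdorff_measure_split_level[OF f])
  also have "{x \<in> E. a + real m \<le> f x} = {x \<in> E. a + real m \<le> f x \<and> f x < a + real m + 1}"
    using Suc.prems by force
  also have "?H ?E = (\<Sum>k<m. ?H {x \<in> ?E. a + real k \<le> f x \<and> f x < a + real k + 1})"
    using Suc.prems by (intro Suc.IH) auto
  also have "\<dots> = (\<Sum>k<m. ?H {x \<in> E. a + real k \<le> f x \<and> f x < a + real k + 1})"
    by (intro sum.cong arg_cong[where f = ?H]) (auto simp flip: of_nat_Suc)
  finally show ?case by simp
qed

section \<open>Volumes of parallelepipeds\<close>

text \<open>Half-open coefficient ranges let translates along a generator fit together without
  overlap; the closed parallelepiped is recovered by a dilation argument in
  \<open>parallelepiped_volume_eq_half_open\<close>.\<close>

definition half_open_parallelepiped :: "nat \<Rightarrow> (nat \<Rightarrow> 'a::real_vector) \<Rightarrow> 'a set" where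
  "half_open_parallelepiped n v = {(\<Sum>i<n. \<alpha> i *\<^sub>R v i) | \<alpha> :: nat \<Rightarrow> real. \<forall>i<n. \<alpha> i \<in> {0..<1}}"

text \<open>A biorthogonal system: pairing with \<open>d j\<close> reads off the coefficient of
  \<open>v j\<close>. In particular \<open>dual_family n e e\<close> expresses
  orthonormality.\<close>

definition dual_family :: "nat \<Rightarrow> (nat \<Rightarrow> 'a::real_inner) \<Rightarrow> (nat \<Rightarrow> 'a) \<Rightarrow> bool" where
  "dual_family n v d \<longleftrightarrow> (\<forall>i<n. \<forall>j<n. v i \<bullet> d j = (if i = j then 1 else 0))"

text \<open>For a dual family this is the linear span of the first n vectors, encoded as the fixed
  points of a coordinate projection, so that membership is a single equation.\<close>

definition family_span :: "nat \<Rightarrow> (nat \<Rightarrow> 'a::real_inner) \<Rightarrow> (nat \<Rightarrow> 'a) \<Rightarrow> 'a set" where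
  "family_span n v d = {x. x = (\<Sum>i<n. (x \<bullet> d i) *\<^sub>R v i)}"

section \<open>Dual families and coordinates\<close>

lemma orthogonal_projection_exists:
  fixes S :: "'a::real_inner set"
  assumes "finite S"
  shows "\<exists>p\<in>span S. \<forall>s\<in>S. (x - p) \<bullet> s = 0"
  using assms
proof (induction S arbitrary: x)
  case (insert a S)
  obtain p q where p: "p \<in> span S" "\<forall>s\<in>S. (x - p) \<bullet> s = 0"
    and q: "q \<in> span S" "\<forall>s\<in>S. (a - q) \<bullet> s = 0"
    using insert.IH by blast
  \<comment> \<open>The vector a - q is the component of a orthogonal to S, and c corrects p along
    it. If a lies in the span of S, this component is 0 and so is c, by division by zero.\<close>
  define c where "c = ((x - p) \<bullet> (a - q)) / ((a - q) \<bullet> (a - q))"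
  have orth: "(x - (p + c *\<^sub>R (a - q))) \<bullet> s = 0" if "s \<in> S" for s
    using p(2) q(2) that by (simp add: inner_simps algebra_simps)
  have "(x - (p + c *\<^sub>R (a - q))) \<bullet> y = 0" if "y \<in> span S" for y
    using that orth by (induction rule: span_induct_alt) (auto simp: inner_add_right)
  then have "(x - (p + c *\<^sub>R (a - q))) \<bullet> q = 0" using q(1) .
  moreover have "(x - (p + c *\<^sub>R w)) \<bullet> w = 0" if "w = a - q" for w
  proof -
    have "(x - (p + c *\<^sub>R w)) \<bullet> w = (x - p) \<bullet> w - c * (w \<bullet> w)"
      by (simp add: inner_diff_left inner_add_left)
    then show ?thesis using that by (cases "w = 0") (simp_all add: c_def)
  qed
  ultimately have "(x - (p + c *\<^sub>R (a - q))) \<bullet> a = 0"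
    by (metis diff_add_cancel inner_add_right add.right_neutral)
  moreover have "p + c *\<^sub>R (a - q) \<in> span (insert a S)"
    using p(1) q(1) span_mono[of S "insert a S"]
    by (intro span_add span_scale span_diff) (auto intro: span_base)
  ultimately show ?case using orth by blast
qed auto

text \<open>Removing an index instead of a vector accounts for repetitions too: if v i = v j with i
  and j distinct, then v j stays in the span of the rest.\<close>

lemma linearly_independent_family_iff:
  "linearly_independent_family n v \<longleftrightarrow> (\<forall>j<n. v j \<notin> span (v ` ({..<n} - {j})))"
proof
  assume "linearly_independent_family n v"
  then have inj: "inj_on v {..<n}" and ind: "independent (v ` {..<n})"
    by (auto simp: linearly_independent_family_def)
  show "\<forall>j<n. v j \<notin> span (v ` ({..<n} - {j}))"
  proof (intro allI impI)
    fix j assume "j < n"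
    then have "v ` ({..<n} - {j}) = v ` {..<n} - {v j}"
      using inj by (simp add: inj_on_image_set_diff)
    then show "v j \<notin> span (v ` ({..<n} - {j}))"
      using ind \<open>j < n\<close> unfolding dependent_def by auto
  qed
next
  assume *: "\<forall>j<n. v j \<notin> span (v ` ({..<n} - {j}))"
  have inj: "inj_on v {..<n}"
  proof (rule inj_onI, rule ccontr)
    fix i j assume "i \<in> {..<n}" "j \<in> {..<n}" "v i = v j" "i \<noteq> j"
    then have "v j \<in> v ` ({..<n} - {j})" by (intro image_eqI[of _ _ i]) auto
    then have "v j \<in> span (v ` ({..<n} - {j}))" by (rule span_base)
    then show False using * \<open>j \<in> {..<n}\<close> by simp
  qed
  have "independent (v ` {..<n})"
    unfolding dependent_def
  proof safe
    fix j assume "j < n" "v j \<in> span (v ` {..<n} - {v j})"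
    moreover have "v ` ({..<n} - {j}) = v ` {..<n} - {v j}"
      using inj \<open>j < n\<close> by (simp add: inj_on_image_set_diff)
    ultimately show False using * by metis
  qed
  then show "linearly_independent_family n v"
    using inj by (simp add: linearly_independent_family_def)
qed

lemma inner_dual_family:
  assumes "dual_family n v d" "j < n"
  shows "(\<Sum>i<n. \<alpha> i *\<^sub>R v i) \<bullet> d j = \<alpha> j"
proof -
  have "(\<Sum>i<n. \<alpha> i *\<^sub>R v i) \<bullet> d j = (\<Sum>i<n. \<alpha> i * (v i \<bullet> d j))"
    by (simp add: inner_sum_left)
  also have "\<dots> = (\<Sum>i<n. if i = j then \<alpha> i else 0)"
    using assms by (intro sum.cong) (auto simp: dual_family_def)
  finally show ?thesis using assms(2) by simp
qed

text \<open>From independence, the dual vector \<open>d j\<close> is the residual of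
  \<open>v j\<close> after projection onto the other vectors, divided by its squared norm.
  Conversely \<open>d j\<close> annihilates the span of the others but not
  \<open>v j\<close>.\<close>

lemma dual_family_exists_iff:
  fixes v :: "nat \<Rightarrow> 'a::real_inner"
  shows "(\<exists>d. dual_family n v d) \<longleftrightarrow> linearly_independent_family n v"
  unfolding linearly_independent_family_iff
proof
  assume "\<exists>d. dual_family n v d"
  then obtain d where d: "dual_family n v d" ..
  show "\<forall>j<n. v j \<notin> span (v ` ({..<n} - {j}))"
  proof (intro allI impI notI)
    fix j assume j: "j < n" "v j \<in> span (v ` ({..<n} - {j}))"
    have "x \<bullet> d j = 0" if "x \<in> span (v ` ({..<n} - {j}))" for x
      using that d j(1) by (induction rule: span_induct_alt) (auto simp: inner_simps dual_family_def)
    then show False using j d by (force simp: dual_family_def)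
  qed
next
  assume *: "\<forall>j<n. v j \<notin> span (v ` ({..<n} - {j}))"
  have "\<exists>e. \<forall>i<n. v i \<bullet> e = (if i = j then 1 else 0)" if j: "j < n" for j
  proof -
    obtain p where p: "p \<in> span (v ` ({..<n} - {j}))" "\<forall>s\<in>v ` ({..<n} - {j}). (v j - p) \<bullet> s = 0"
      using orthogonal_projection_exists[of "v ` ({..<n} - {j})" "v j"] by auto
    define r where "r = v j - p"
    have "r \<noteq> 0" using * j p(1) by (auto simp: r_def)
    have "r \<bullet> x = 0" if "x \<in> span (v ` ({..<n} - {j}))" for x
      using that p(2) by (induction rule: span_induct_alt) (auto simp: inner_simps r_def)
    then have "r \<bullet> p = 0" using p(1) by simp
    then have "v j \<bullet> r = r \<bullet> r" by (simp add: r_def inner_commute inner_diff_right)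
    moreover have "v i \<bullet> r = 0" if "i < n" "i \<noteq> j" for i
      using p(2) that by (auto simp: r_def inner_commute)
    ultimately show ?thesis
      using \<open>r \<noteq> 0\<close> by (intro exI[of _ "r /\<^sub>R (r \<bullet> r)"]) auto
  qed
  then have "\<exists>d. \<forall>j<n. \<forall>i<n. v i \<bullet> d j = (if i = j then 1 else 0)" by metis
  then show "\<exists>d. dual_family n v d" unfolding dual_family_def by blast
qed

text \<open>The dual family transforms contragrediently: adding t times \<open>v i\<close> to
  \<open>v j\<close> costs the \<open>v i\<close>-coordinate t times the
  \<open>v j\<close>-coordinate.\<close>

lemma dual_family_shear:
  assumes "dual_family n v d" "i < n" "j < n" "i \<noteq> j"
  shows "dual_family n (v(j := v j + t *\<^sub>R v i)) (d(i := d i - t *\<^sub>R d j))"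
  using assms unfolding dual_family_def by (auto simp: inner_simps)

lemma dual_family_scale:
  assumes "dual_family n v d" "j < n" "s \<noteq> 0"
  shows "dual_family n (v(j := s *\<^sub>R v j)) (d(j := d j /\<^sub>R s))"
  using assms unfolding dual_family_def by auto

lemma family_span_add_scale:
  assumes "dual_family n v d" "i < n" "x \<in> family_span n v d"
  shows "x + c *\<^sub>R v i \<in> family_span n v d"
proof -
  have "(\<Sum>k<n. (v i \<bullet> d k) *\<^sub>R v k) = (\<Sum>k<n. if k = i then v i else 0)"
    using assms(1,2) by (intro sum.cong) (auto simp: dual_family_def)
  then have "(\<Sum>k<n. (v i \<bullet> d k) *\<^sub>R v k) = v i" using assms(2) by simp
  moreover have "(\<Sum>k<n. (c * (v i \<bullet> d k)) *\<^sub>R v k) = c *\<^sub>R (\<Sum>k<n. (v i \<bullet> d k) *\<^sub>R v k)"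
    by (simp add: scaleR_sum_right)
  ultimately show ?thesis
    using assms(3) by (simp add: family_span_def inner_add_left scaleR_left_distrib sum.distrib)
qed

lemma half_open_parallelepiped_dual:
  assumes "dual_family n v d"
  shows "half_open_parallelepiped n v = {x \<in> family_span n v d. \<forall>k<n. 0 \<le> x \<bullet> d k \<and> x \<bullet> d k < 1}"
proof (intro equalityI subsetI)
  fix x assume "x \<in> half_open_parallelepiped n v"
  then obtain \<alpha> where x: "x = (\<Sum>i<n. \<alpha> i *\<^sub>R v i)" and \<alpha>: "\<forall>i<n. \<alpha> i \<in> {0..<1::real}"
    unfolding half_open_parallelepiped_def by blast
  have c: "x \<bullet> d k = \<alpha> k" if "k < n" for k
    unfolding x using inner_dual_family[OF assms that] .
  then have "(\<Sum>i<n. (x \<bullet> d i) *\<^sub>R v i) = x" by (simp add: x)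
  then show "x \<in> {x \<in> family_span n v d. \<forall>k<n. 0 \<le> x \<bullet> d k \<and> x \<bullet> d k < 1}"
    using c \<alpha> by (auto simp: family_span_def)
next
  fix x assume "x \<in> {x \<in> family_span n v d. \<forall>k<n. 0 \<le> x \<bullet> d k \<and> x \<bullet> d k < 1}"
  then show "x \<in> half_open_parallelepiped n v"
    unfolding half_open_parallelepiped_def family_span_def
    by (intro CollectI exI[of _ "\<lambda>k. x \<bullet> d k"]) auto
qed

lemma family_span_shear:
  assumes "i < n" "j < n" "i \<noteq> j"
  shows "family_span n (v(j := v j + t *\<^sub>R v i)) (d(i := d i - t *\<^sub>R d j)) = family_span n v d"
proof -
  have "(\<Sum>k<n. (x \<bullet> (d(i := d i - t *\<^sub>R d j)) k) *\<^sub>R (v(j := v j + t *\<^sub>R v i)) k)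
      = (\<Sum>k<n. (x \<bullet> d k) *\<^sub>R v k)" for x
  proof -
    \<comment> \<open>Only the summands i and j change, by opposite multiples of
      \<open>v i\<close>.\<close>
    have "(\<Sum>k<n. (x \<bullet> (d(i := d i - t *\<^sub>R d j)) k) *\<^sub>R (v(j := v j + t *\<^sub>R v i)) k)
      = (\<Sum>k<n. (x \<bullet> d k) *\<^sub>R v k + (if k = i then - (t * (x \<bullet> d j)) *\<^sub>R v i else 0)
          + (if k = j then (t * (x \<bullet> d j)) *\<^sub>R v i else 0))"
      using assms by (intro sum.cong) (auto simp: algebra_simps)
    also have "\<dots> = (\<Sum>k<n. (x \<bullet> d k) *\<^sub>R v k)"
      using assms by (simp add: sum.distrib)
    finally show ?thesis .
  qed
  then show ?thesis by (simp add: family_span_def)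
qed

lemma family_span_scale:
  assumes "s \<noteq> 0"
  shows "family_span n (v(j := s *\<^sub>R v j)) (d(j := d j /\<^sub>R s)) = family_span n v d"
proof -
  have "(\<Sum>k<n. (x \<bullet> (d(j := d j /\<^sub>R s)) k) *\<^sub>R (v(j := s *\<^sub>R v j)) k) = (\<Sum>k<n. (x \<bullet> d k) *\<^sub>R v k)" for x
    using assms by (intro sum.cong) auto
  then show ?thesis by (simp add: family_span_def)
qed

section \<open>Shears, scalings and finiteness for half-open parallelepipeds\<close>

lemma lipschitz_on_inner_left: "(norm d)-lipschitz_on UNIV (\<lambda>x. x \<bullet> d)"
proof (rule lipschitz_onI)
  fix x y :: 'a
  have "\<bar>(x - y) \<bullet> d\<bar> \<le> norm (x - y) * norm d" by (rule Cauchy_Schwarz_ineq2)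
  then show "dist (x \<bullet> d) (y \<bullet> d) \<le> norm d * dist x y"
    by (simp add: dist_norm inner_diff_left mult.commute)
qed simp

lemma hausdorff_measure_translate:
  fixes A :: "'a::real_normed_vector set"
  assumes "0 < n"
  shows "hausdorff_measure n ((\<lambda>x. x + a) ` A) = hausdorff_measure n A"
  using assms by (rule hausdorff_measure_isometric_image) simp

text \<open>Cut and paste: the lattice generated by \<open>v i\<close> acts on the span of the family by translations, and
  both parallelepipeds are fundamental domains of the same cylinder for this action.\<close>

lemma hausdorff_measure_shear:
  fixes v :: "nat \<Rightarrow> 'a::real_inner"
  assumes d: "dual_family n v d" and ij: "i < n" "j < n" "i \<noteq> j"
  shows "hausdorff_measure n (half_open_parallelepiped n (v(j := v j + t *\<^sub>R v i)))
    = hausdorff_measure n (half_open_parallelepiped n v)"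
proof -
  let ?H = "hausdorff_measure n"
  \<comment> \<open>This is the i-th dual vector of the sheared family. All other dual vectors are
    unchanged, so both parallelepipeds lie in the cylinder Z, which leaves the direction
    \<open>v i\<close> free.\<close>
  define e where "e = d i - t *\<^sub>R d j"
  define Z where "Z = {x \<in> family_span n v d. \<forall>k<n. k \<noteq> i \<longrightarrow> 0 \<le> x \<bullet> d k \<and> x \<bullet> d k < 1}"
  define N where "N = nat \<lceil>\<bar>t\<bar>\<rceil> + 1"
  have N: "\<bar>t\<bar> + 1 \<le> real N" unfolding N_def by linarith
  define P where "P = {x \<in> Z. 0 \<le> x \<bullet> d i \<and> x \<bullet> d i < 1}"
  define S where "S = {x \<in> Z. 0 \<le> x \<bullet> e \<and> x \<bullet> e < 1}"
  have P: "half_open_parallelepiped n v = P"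
    unfolding half_open_parallelepiped_dual[OF d] P_def Z_def using ij by auto
  have S: "half_open_parallelepiped n (v(j := v j + t *\<^sub>R v i)) = S"
    unfolding half_open_parallelepiped_dual[OF dual_family_shear[OF d ij]] family_span_shear[OF ij]
      S_def Z_def e_def using ij by auto
  \<comment> \<open>The \<open>v j\<close>-coordinate is in the unit interval on Z, so the two
    competing i-th coordinates differ by at most \<bar>t\<bar>; hence 2 * N unit slabs
    suffice.\<close>
  have bd: "\<bar>x \<bullet> e - x \<bullet> d i\<bar> \<le> \<bar>t\<bar>" if "x \<in> Z" for x
  proof -
    have "\<bar>x \<bullet> d j\<bar> \<le> 1" using that ij by (auto simp: Z_def)
    then have "\<bar>t\<bar> * \<bar>x \<bullet> d j\<bar> \<le> \<bar>t\<bar>" by (intro mult_left_le) auto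
    then show ?thesis by (simp add: e_def inner_diff_right abs_mult)
  qed
  have Zshift: "x + c *\<^sub>R v i \<in> Z" if "x \<in> Z" for x c
    using that family_span_add_scale[OF d ij(1)] d ij(1)
    by (auto simp: Z_def inner_add_left dual_family_def)
  have vd: "v i \<bullet> d i = 1" "v i \<bullet> e = 1"
    using d ij by (auto simp: dual_family_def e_def inner_diff_right)
  \<comment> \<open>Translation by c times \<open>v i\<close> raises both i-th coordinates by c,
    which exchanges the roles of the constraint and the slab condition.\<close>
  have shift: "?H {x \<in> S. c \<le> x \<bullet> d i \<and> x \<bullet> d i < c + 1} = ?H {y \<in> P. - c \<le> y \<bullet> e \<and> y \<bullet> e < - c + 1}" for c
  proof -
    have "{x \<in> S. c \<le> x \<bullet> d i \<and> x \<bullet> d i < c + 1} = (\<lambda>y. y + c *\<^sub>R v i) ` {y \<in> P. - c \<le> y \<bullet> e \<and> y \<bullet> e < - c + 1}"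
    proof (intro equalityI subsetI)
      fix x assume "x \<in> {x \<in> S. c \<le> x \<bullet> d i \<and> x \<bullet> d i < c + 1}"
      then show "x \<in> (\<lambda>y. y + c *\<^sub>R v i) ` {y \<in> P. - c \<le> y \<bullet> e \<and> y \<bullet> e < - c + 1}"
        using Zshift[of x "- c"] vd
        by (intro image_eqI[of _ _ "x + (- c) *\<^sub>R v i"]) (auto simp: P_def S_def inner_diff_left)
    qed (use Zshift vd in \<open>auto simp: P_def S_def inner_add_left\<close>)
    then show ?thesis
      using ij hausdorff_measure_translate[of n] by simp
  qed
  have "?H S = (\<Sum>k<2*N. ?H {x \<in> S. - real N + real k \<le> x \<bullet> d i \<and> x \<bullet> d i < - real N + real k + 1})"
  proof (rule hausdorff_measure_slabs[OF lipschitz_on_inner_left])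
    fix x assume "x \<in> S"
    then show "- real N \<le> x \<bullet> d i \<and> x \<bullet> d i < - real N + real (2 * N)"
      using bd[of x] N by (auto simp: S_def)
  qed
  also have "\<dots> = (\<Sum>k<2*N. ?H {y \<in> P. real N - real k \<le> y \<bullet> e \<and> y \<bullet> e < real N - real k + 1})"
    unfolding shift by simp
  \<comment> \<open>The translated slabs run downwards from level N to 1 - N; reversing the index
    puts them in the increasing order that the slab lemma expects.\<close>
  also have "\<dots> = (\<Sum>k<2*N. ?H {y \<in> P. real N - real (2*N - Suc k) \<le> y \<bullet> e \<and> y \<bullet> e < real N - real (2*N - Suc k) + 1})"
    by (rule sum.nat_diff_reindex[symmetric])
  also have "\<dots> = (\<Sum>k<2*N. ?H {y \<in> P. (1 - real N) + real k \<le> y \<bullet> e \<and> y \<bullet> e < (1 - real N) + real k + 1})"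
  proof (rule sum.cong)
    fix k assume "k \<in> {..<2*N}"
    then have "real N - real (2*N - Suc k) = (1 - real N) + real k"
      by (simp add: of_nat_diff)
    then show "?H {y \<in> P. real N - real (2*N - Suc k) \<le> y \<bullet> e \<and> y \<bullet> e < real N - real (2*N - Suc k) + 1}
        = ?H {y \<in> P. (1 - real N) + real k \<le> y \<bullet> e \<and> y \<bullet> e < (1 - real N) + real k + 1}"
      by presburger
  qed simp
  also have "\<dots> = ?H P"
  proof (rule hausdorff_measure_slabs[OF lipschitz_on_inner_left, symmetric])
    fix x assume "x \<in> P"
    then show "1 - real N \<le> x \<bullet> e \<and> x \<bullet> e < 1 - real N + real (2 * N)"
      using bd[of x] N by (auto simp: P_def)
  qed
  finally show ?thesis by (simp add: P S)
qed

text \<open>Cauchy's functional equation on the positive reals: nonnegativity forces monotonicity,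
  which replaces continuity in the passage from integer multiples to real ones.\<close>

lemma additive_nonneg_imp_linear:
  fixes h :: "real \<Rightarrow> real"
  assumes add: "\<And>s r. 0 < s \<Longrightarrow> 0 < r \<Longrightarrow> h (s + r) = h s + h r"
    and nonneg: "\<And>s. 0 < s \<Longrightarrow> 0 \<le> h s" and "0 < s"
  shows "h s = s * h 1"
proof -
  have mono: "h r \<le> h s" if "0 < r" "r \<le> s" for r s
    using that add[of r "s - r"] nonneg[of "s - r"] by (cases "r = s") auto
  have mult: "h (real (Suc k) * s) = real (Suc k) * h s" if "0 < s" for k s
  proof (induction k)
    case (Suc k)
    have "h (real (Suc k) * s + s) = h (real (Suc k) * s) + h s" using that by (intro add) auto
    then show ?case using Suc by (simp add: algebra_simps)
  qed simp
  \<comment> \<open>With l the integer part of (k+1) s, both (k+1) h s and (k+1) s h 1 lie between l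
    h 1 and (l+1) h 1. The error is thus at most h 1 / (k+1) for every k.\<close>
  have "\<bar>h s - s * h 1\<bar> * real (Suc k) \<le> h 1" for k
  proof -
    define l where "l = nat \<lfloor>real (Suc k) * s\<rfloor>"
    have l: "real l \<le> real (Suc k) * s" "real (Suc k) * s \<le> real (Suc l)"
      using \<open>0 < s\<close> by (simp_all add: l_def) linarith
    have "real l * h 1 \<le> h (real (Suc k) * s)"
    proof (cases l)
      case 0 then show ?thesis using nonneg[of "real (Suc k) * s"] \<open>0 < s\<close> by simp
    next
      case (Suc m)
      then show ?thesis using mult[of 1 m] mono[of "real (Suc m)" "real (Suc k) * s"] l by simp
    qed
    moreover have "h (real (Suc k) * s) \<le> real (Suc l) * h 1"
      using mult[of 1 l] mono[of "real (Suc k) * s" "real (Suc l)"] l \<open>0 < s\<close> by simp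
    ultimately have "real l * h 1 \<le> real (Suc k) * h s" "real (Suc k) * h s \<le> real (Suc l) * h 1"
      using mult[OF \<open>0 < s\<close>] by auto
    moreover have "real l * h 1 \<le> real (Suc k) * s * h 1" "real (Suc k) * s * h 1 \<le> real (Suc l) * h 1"
      using l nonneg[of 1] by (auto intro: mult_right_mono)
    ultimately have "\<bar>real (Suc k) * h s - real (Suc k) * s * h 1\<bar> \<le> h 1"
      by (simp add: algebra_simps)
    moreover have "real (Suc k) * h s - real (Suc k) * s * h 1 = (h s - s * h 1) * real (Suc k)"
      by (simp add: algebra_simps)
    ultimately show ?thesis by (simp only: abs_mult abs_of_nat)
  qed
  then have le: "real k * \<bar>h s - s * h 1\<bar> \<le> h 1" for k
    using nonneg[of 1] by (cases k) (simp_all add: mult.commute)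
  show ?thesis
  proof (rule ccontr)
    assume "h s \<noteq> s * h 1"
    then obtain k where "h 1 < real k * \<bar>h s - s * h 1\<bar>"
      using reals_Archimedean3[of "\<bar>h s - s * h 1\<bar>"] by auto
    then show False using le[of k] by simp
  qed
qed

text \<open>Dividing every coefficient range into m equal parts gives m ^ n cells of diameter at
  most D / m, so the number of cells cancels against their weights.\<close>

lemma hausdorff_measure_half_open_parallelepiped_le:
  fixes v :: "nat \<Rightarrow> 'a::real_normed_vector"
  assumes n: "0 < n"
  shows "hausdorff_measure n (half_open_parallelepiped n v)
    \<le> ennreal (unit_ball_vol (real n) * ((\<Sum>i<n. norm (v i)) / 2) ^ n)"
proof (rule hausdorff_measure_leI)
  fix \<delta> :: real assume \<delta>: "0 < \<delta>"
  define D where "D = (\<Sum>i<n. norm (v i))"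
  have D: "0 \<le> D" by (simp add: D_def sum_nonneg)
  \<comment> \<open>Large enough that cells have diameter at most \<delta>; the summand 1 keeps m
    positive even when D = 0.\<close>
  define m where "m = nat \<lceil>D / \<delta>\<rceil> + 1"
  have m: "0 < m" "D / \<delta> \<le> real m" unfolding m_def by (auto; linarith)+
  have Dm: "D / real m \<le> \<delta>" using m \<delta> by (simp add: field_simps)
  define K where "K = PiE {..<n} (\<lambda>_. {..<m})"
  define U where "U \<kappa> = {(\<Sum>i<n. \<alpha> i *\<^sub>R v i) | \<alpha> :: nat \<Rightarrow> real.
      \<forall>i<n. real (\<kappa> i) / real m \<le> \<alpha> i \<and> \<alpha> i < (real (\<kappa> i) + 1) / real m}" for \<kappa> :: "nat \<Rightarrow> nat"
  have K: "finite K" "card K = m ^ n"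
    by (simp_all add: K_def finite_PiE card_PiE)
  have dist: "dist x y \<le> D / real m" if xy: "x \<in> U \<kappa>" "y \<in> U \<kappa>" for x y \<kappa>
  proof -
    obtain \<alpha> \<beta> :: "nat \<Rightarrow> real" where x: "x = (\<Sum>i<n. \<alpha> i *\<^sub>R v i)" and y: "y = (\<Sum>i<n. \<beta> i *\<^sub>R v i)"
      and \<alpha>: "\<forall>i<n. real (\<kappa> i) / real m \<le> \<alpha> i \<and> \<alpha> i < (real (\<kappa> i) + 1) / real m"
      and \<beta>: "\<forall>i<n. real (\<kappa> i) / real m \<le> \<beta> i \<and> \<beta> i < (real (\<kappa> i) + 1) / real m"
      using xy unfolding U_def by blast
    have "dist x y = norm (\<Sum>i<n. (\<alpha> i - \<beta> i) *\<^sub>R v i)"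
      by (simp add: x y dist_norm scaleR_left_diff_distrib sum_subtractf)
    also have "\<dots> \<le> (\<Sum>i<n. norm ((\<alpha> i - \<beta> i) *\<^sub>R v i))"
      by (rule norm_sum)
    also have "\<dots> \<le> (\<Sum>i<n. (1 / real m) * norm (v i))"
    proof (rule sum_mono)
      fix i assume i: "i \<in> {..<n}"
      then have "\<bar>\<alpha> i - \<beta> i\<bar> \<le> 1 / real m"
        using \<alpha>[rule_format, of i] \<beta>[rule_format, of i] by (simp add: add_divide_distrib abs_if)
      then show "norm ((\<alpha> i - \<beta> i) *\<^sub>R v i) \<le> (1 / real m) * norm (v i)"
        unfolding norm_scaleR by (rule mult_right_mono) simp
    qed
    also have "\<dots> = D / real m"
      by (simp add: D_def sum_divide_distrib)
    finally show ?thesis .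
  qed
  have bd: "bounded (U \<kappa>)" for \<kappa>
    using dist[of _ \<kappa>] unfolding bounded_two_points by blast
  have diam: "diameter (U \<kappa>) \<le> D / real m" for \<kappa>
    using dist[of _ \<kappa>] D by (auto simp: diameter_def intro!: cSUP_least)
  have cover: "half_open_parallelepiped n v \<subseteq> (\<Union>\<kappa>\<in>K. U \<kappa>)"
  proof
    fix x assume "x \<in> half_open_parallelepiped n v"
    then obtain \<alpha> :: "nat \<Rightarrow> real" where x: "x = (\<Sum>i<n. \<alpha> i *\<^sub>R v i)" and \<alpha>: "\<forall>i<n. \<alpha> i \<in> {0..<1}"
      unfolding half_open_parallelepiped_def by blast
    define \<kappa> where "\<kappa> = restrict (\<lambda>i. nat \<lfloor>\<alpha> i * real m\<rfloor>) {..<n}"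
    have fl: "real (nat \<lfloor>\<alpha> i * real m\<rfloor>) \<le> \<alpha> i * real m" "\<alpha> i * real m < real (nat \<lfloor>\<alpha> i * real m\<rfloor>) + 1"
      if "i < n" for i
    proof -
      have "0 \<le> \<alpha> i * real m" using \<alpha> that by auto
      then show "real (nat \<lfloor>\<alpha> i * real m\<rfloor>) \<le> \<alpha> i * real m" "\<alpha> i * real m < real (nat \<lfloor>\<alpha> i * real m\<rfloor>) + 1"
        by linarith+
    qed
    have "\<kappa> \<in> K"
      unfolding K_def \<kappa>_def
    proof (rule restrict_PiE_iff[THEN iffD2], intro ballI)
      fix i assume i: "i \<in> {..<n}"
      then have "\<alpha> i * real m < real m" using \<alpha> m by auto
      then show "nat \<lfloor>\<alpha> i * real m\<rfloor> \<in> {..<m}" using fl(1)[of i] i by simp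
    qed
    moreover have "x \<in> U \<kappa>"
      unfolding U_def x
      by (intro CollectI exI[of _ \<alpha>] conjI refl) (use fl m in \<open>auto simp: \<kappa>_def field_simps\<close>)
    ultimately show "x \<in> (\<Union>\<kappa>\<in>K. U \<kappa>)" by blast
  qed
  have "hausdorff_premeasure n \<delta> (half_open_parallelepiped n v) \<le> (\<Sum>\<kappa>\<in>K. hausdorff_weight n (U \<kappa>))"
    using diam Dm order_trans by (intro hausdorff_premeasure_finite_cover_le K cover bd \<delta>) blast
  also have "\<dots> \<le> (\<Sum>\<kappa>\<in>K. ennreal (unit_ball_vol (real n) * (D / real m / 2) ^ n))"
  proof (rule sum_mono)
    fix \<kappa>
    have "(diameter (U \<kappa>) / 2) ^ n \<le> (D / real m / 2) ^ n"
      using diam[of \<kappa>] diameter_ge_0[OF bd[of \<kappa>]] by (intro power_mono) auto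
    then show "hausdorff_weight n (U \<kappa>) \<le> ennreal (unit_ball_vol (real n) * (D / real m / 2) ^ n)"
      by (auto simp: hausdorff_weight_def intro!: ennreal_leI mult_left_mono)
  qed
  also have "\<dots> = ennreal (real (m ^ n) * (unit_ball_vol (real n) * (D / real m / 2) ^ n))"
    using D by (simp add: K ennreal_mult'' ennreal_of_nat_eq_real_of_nat)
  also have "real (m ^ n) * (unit_ball_vol (real n) * (D / real m / 2) ^ n) = unit_ball_vol (real n) * (D / 2) ^ n"
    using m by (simp add: power_divide)
  finally show "hausdorff_premeasure n \<delta> (half_open_parallelepiped n v)
    \<le> ennreal (unit_ball_vol (real n) * ((\<Sum>i<n. norm (v i)) / 2) ^ n)"
    by (simp add: D_def)
qed

lemma hausdorff_measure_half_open_parallelepiped_finite: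
  fixes v :: "nat \<Rightarrow> 'a::real_normed_vector"
  assumes "0 < n"
  shows "hausdorff_measure n (half_open_parallelepiped n v) < Orderings.top"
  using hausdorff_measure_half_open_parallelepiped_le[OF assms, of v] by (simp add: le_less_trans)

text \<open>As a function of the length r in direction \<open>v j\<close>, the measure is additive:
  cut at level s and translate the upper piece back. Being finite and nonnegative, it is linear in
  r.\<close>

lemma hausdorff_measure_scale:
  fixes v :: "nat \<Rightarrow> 'a::real_inner"
  assumes d: "dual_family n v d" and j: "j < n" and s: "0 < s"
  shows "hausdorff_measure n (half_open_parallelepiped n (v(j := s *\<^sub>R v j)))
    = ennreal s * hausdorff_measure n (half_open_parallelepiped n v)"
proof -
  let ?H = "hausdorff_measure n"
  have n: "0 < n" using j by simp
  define Z where "Z = {x \<in> family_span n v d. \<forall>k<n. k \<noteq> j \<longrightarrow> 0 \<le> x \<bullet> d k \<and> x \<bullet> d k < 1}"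
  define Q where "Q r = {x \<in> Z. 0 \<le> x \<bullet> d j \<and> x \<bullet> d j < r}" for r
  have Q: "half_open_parallelepiped n (v(j := r *\<^sub>R v j)) = Q r" if "0 < r" for r
  proof -
    have r: "r \<noteq> 0" using that by simp
    show ?thesis
      unfolding half_open_parallelepiped_dual[OF dual_family_scale[OF d j r]] family_span_scale[OF r]
        Q_def Z_def using j that by (auto simp: field_simps)
  qed
  have Q1: "half_open_parallelepiped n v = Q 1" using Q[of 1] by simp
  have fin: "?H (Q r) < Orderings.top" if "0 < r" for r
    using Q[OF that] hausdorff_measure_half_open_parallelepiped_finite[OF n] by metis
  have vd: "v j \<bullet> d j = 1" using d j by (auto simp: dual_family_def)
  have Zshift: "x + c *\<^sub>R v j \<in> Z" if "x \<in> Z" for x c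
    using that family_span_add_scale[OF d j] d j
    by (auto simp: Z_def inner_add_left dual_family_def)
  have add: "?H (Q (s + r)) = ?H (Q s) + ?H (Q r)" if "0 < s" "0 < r" for s r
  proof -
    have "{x \<in> Q (s + r). s \<le> x \<bullet> d j} = (\<lambda>x. x + s *\<^sub>R v j) ` Q r"
    proof (intro equalityI subsetI)
      fix x assume "x \<in> {x \<in> Q (s + r). s \<le> x \<bullet> d j}"
      then show "x \<in> (\<lambda>x. x + s *\<^sub>R v j) ` Q r"
        using Zshift[of x "- s"] vd
        by (intro image_eqI[of _ _ "x + (- s) *\<^sub>R v j"]) (auto simp: Q_def inner_diff_left)
    qed (use Zshift vd that in \<open>auto simp: Q_def inner_add_left\<close>)
    then have "?H {x \<in> Q (s + r). s \<le> x \<bullet> d j} = ?H (Q r)"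
      using n hausdorff_measure_translate[of n] by simp
    moreover have "{x \<in> Q (s + r). x \<bullet> d j < s} = Q s"
      using that by (auto simp: Q_def)
    ultimately show ?thesis
      using hausdorff_measure_split_level[OF lipschitz_on_inner_left, of n "Q (s + r)" "d j" s] by simp
  qed
  have "enn2real (?H (Q s)) = s * enn2real (?H (Q 1))"
  proof (rule additive_nonneg_imp_linear[OF _ _ s])
    fix s r :: real assume "0 < s" "0 < r"
    then show "enn2real (?H (Q (s + r))) = enn2real (?H (Q s)) + enn2real (?H (Q r))"
      using add fin by (simp add: enn2real_plus)
  qed simp
  then have "ennreal (enn2real (?H (Q s))) = ennreal s * ennreal (enn2real (?H (Q 1)))"
    using s by (simp add: ennreal_mult)
  then show ?thesis
    using fin s by (simp add: Q Q1)
qed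

text \<open>For every r > 1 the closed parallelepiped lies in the r-fold dilate of the half-open
  one, which costs at most the factor r ^ n; then r tends to 1.\<close>

lemma parallelepiped_volume_eq_half_open:
  fixes v :: "nat \<Rightarrow> 'a::real_normed_vector"
  assumes n: "0 < n" and v: "linearly_independent_family n v"
  shows "parallelepiped_volume n v = hausdorff_measure n (half_open_parallelepiped n v)"
proof (rule antisym)
  let ?H = "hausdorff_measure n"
  have P: "parallelepiped n v = {(\<Sum>i<n. \<alpha> i *\<^sub>R v i) | \<alpha> :: nat \<Rightarrow> real. \<forall>i<n. \<alpha> i \<in> {0..1}}"
    using v by (simp add: parallelepiped_def)
  show "?H (half_open_parallelepiped n v) \<le> parallelepiped_volume n v"
    unfolding parallelepiped_volume_def P half_open_parallelepiped_def
    by (intro hausdorff_measure_mono Collect_mono ex_mono) auto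
  obtain h where h: "?H (half_open_parallelepiped n v) = ennreal h" "0 \<le> h"
    using hausdorff_measure_half_open_parallelepiped_finite[OF n, of v]
    by (cases "?H (half_open_parallelepiped n v)") auto
  have le: "parallelepiped_volume n v \<le> ennreal (r ^ n * h)" if r: "1 < r" for r
  proof -
    have "parallelepiped n v \<subseteq> (\<lambda>x. r *\<^sub>R x) ` half_open_parallelepiped n v"
    proof
      fix x assume "x \<in> parallelepiped n v"
      then obtain \<alpha> :: "nat \<Rightarrow> real" where x: "x = (\<Sum>i<n. \<alpha> i *\<^sub>R v i)" and \<alpha>: "\<forall>i<n. \<alpha> i \<in> {0..1}"
        unfolding P by blast
      have "(\<Sum>i<n. (\<alpha> i / r) *\<^sub>R v i) \<in> half_open_parallelepiped n v"
        unfolding half_open_parallelepiped_def using \<alpha> r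
        by (intro CollectI exI[of _ "\<lambda>i. \<alpha> i / r"]) (auto intro: le_less_trans)
      moreover have "x = r *\<^sub>R (\<Sum>i<n. (\<alpha> i / r) *\<^sub>R v i)"
        using r by (simp add: x scaleR_sum_right)
      ultimately show "x \<in> (\<lambda>x. r *\<^sub>R x) ` half_open_parallelepiped n v" by blast
    qed
    then have "parallelepiped_volume n v \<le> ?H ((\<lambda>x. r *\<^sub>R x) ` half_open_parallelepiped n v)"
      unfolding parallelepiped_volume_def by (rule hausdorff_measure_mono)
    also have "\<dots> \<le> ennreal (r ^ n) * ?H (half_open_parallelepiped n v)"
      using n r by (intro hausdorff_measure_lipschitz_image_le)
        (auto simp: dist_norm scaleR_diff_right[symmetric])
    finally show ?thesis using h r by (simp add: ennreal_mult)
  qed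
  have "(\<lambda>k. ennreal ((1 + 1 / real (Suc k)) ^ n * h)) \<longlonglongrightarrow> ennreal ((1 + 0) ^ n * h)"
    by (intro tendsto_intros LIMSEQ_Suc[OF lim_1_over_n])
  then show "parallelepiped_volume n v \<le> ?H (half_open_parallelepiped n v)"
    unfolding h using le by (intro LIMSEQ_le_const) auto
qed

section \<open>Orthonormal families: positivity and uniqueness of the normalising constant\<close>

lemma hausdorff_measure_orthonormal_pos:
  fixes e :: "nat \<Rightarrow> 'a::real_inner"
  assumes n: "0 < n" and e: "dual_family n e e"
  shows "0 < hausdorff_measure n (half_open_parallelepiped n e)"
proof -
  interpret product_sigma_finite "\<lambda>_::nat. lborel :: real measure" ..
  let ?M = "PiM {..<n} (\<lambda>_::nat. lborel :: real measure)"
  \<comment> \<open>Chosen so that c times the volume of a cube of side 2 * diameter is exactly the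
    Hausdorff weight.\<close>
  define c where "c = unit_ball_vol (real n) / 4 ^ n"
  have c: "0 < c" by (simp add: c_def)
  have four: "(4::real) ^ n = 2 ^ n * 2 ^ n" by (simp flip: power_mult_distrib)
  have "ennreal c \<le> (\<Sum>i. hausdorff_weight n (U i))"
    if cover: "half_open_parallelepiped n e \<subseteq> (\<Union>i. U i)" and U: "\<forall>i. bounded (U i) \<and> diameter (U i) \<le> 1"
    for U :: "nat \<Rightarrow> 'a set"
  proof -
    \<comment> \<open>In the coordinates given by e, each nonempty covering set lies in a cube
      around one of its points with the diameter as half side. These cubes cover the unit cube, so
      Lebesgue measure bounds the total weight from below.\<close>
    define x where "x i = (SOME x. x \<in> U i)" for i
    define B where "B i = (if U i = {} then {} else PiE {..<n}
        (\<lambda>k. {x i \<bullet> e k - diameter (U i) .. x i \<bullet> e k + diameter (U i)}))" for i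
    have B_sets: "B i \<in> sets ?M" for i
      by (auto simp: B_def intro!: sets_PiM_I_finite)
    have weight: "ennreal c * emeasure ?M (B i) = hausdorff_weight n (U i)" for i
    proof (cases "U i = {}")
      case False
      have diam: "0 \<le> diameter (U i)" using U diameter_ge_0 by blast
      then have "emeasure ?M (B i) = ennreal ((2 * diameter (U i)) ^ n)"
        using False by (simp add: B_def emeasure_PiM prod_constant ennreal_power)
      then have "ennreal c * emeasure ?M (B i) = ennreal (c * (2 * diameter (U i)) ^ n)"
        using c by (simp add: ennreal_mult')
      also have "c * (2 * diameter (U i)) ^ n = unit_ball_vol (real n) * (diameter (U i) / 2) ^ n"
        using four by (simp add: c_def power_mult_distrib power_divide)
      finally show ?thesis using False by (simp add: hausdorff_weight_def)
    qed (simp add: B_def)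
    have sub: "PiE {..<n} (\<lambda>_. {0..<1::real}) \<subseteq> (\<Union>i. B i)"
    proof
      fix \<alpha> assume \<alpha>: "\<alpha> \<in> PiE {..<n} (\<lambda>_. {0..<1::real})"
      define y where "y = (\<Sum>i<n. \<alpha> i *\<^sub>R e i)"
      have "\<forall>i<n. \<alpha> i \<in> {0..<1}" using \<alpha> by (auto simp: PiE_iff)
      then have "y \<in> half_open_parallelepiped n e"
        unfolding half_open_parallelepiped_def y_def by (intro CollectI exI[of _ \<alpha>] conjI refl)
      then obtain i where i: "y \<in> U i" using cover by blast
      then have xi: "x i \<in> U i" unfolding x_def by (rule someI)
      have "\<bar>\<alpha> k - x i \<bullet> e k\<bar> \<le> diameter (U i)" if "k < n" for k
      proof -
        have "e k \<bullet> e k = 1" using e that by (simp add: dual_family_def)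
        then have "norm (e k) = 1" by (simp add: norm_eq_sqrt_inner)
        then have "\<bar>(y - x i) \<bullet> e k\<bar> \<le> dist y (x i)"
          using Cauchy_Schwarz_ineq2[of "y - x i" "e k"] by (simp add: dist_norm)
        also have "\<dots> \<le> diameter (U i)"
          using U i xi by (intro diameter_bounded_bound) auto
        finally show ?thesis
          using inner_dual_family[OF e that] by (simp add: y_def inner_diff_left)
      qed
      then have "\<alpha> \<in> B i"
        using \<alpha> i by (auto simp: B_def PiE_iff abs_le_iff algebra_simps)
      then show "\<alpha> \<in> (\<Union>i. B i)" by blast
    qed
    have "ennreal c = ennreal c * emeasure ?M (PiE {..<n} (\<lambda>_. {0..<1::real}))"
      by (simp add: emeasure_PiM)
    also have "\<dots> \<le> ennreal c * emeasure ?M (\<Union>i. B i)"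
      using B_sets by (intro mult_left_mono emeasure_mono sub) auto
    also have "\<dots> \<le> ennreal c * (\<Sum>i. emeasure ?M (B i))"
      using B_sets by (intro mult_left_mono emeasure_subadditive_countably) auto
    also have "\<dots> = (\<Sum>i. hausdorff_weight n (U i))"
      by (simp add: weight flip: ennreal_suminf_cmult)
    finally show ?thesis .
  qed
  then have "ennreal c \<le> hausdorff_premeasure n 1 (half_open_parallelepiped n e)"
    unfolding hausdorff_premeasure_def by (intro Inf_greatest) auto
  also have "\<dots> \<le> hausdorff_measure n (half_open_parallelepiped n e)"
    by (rule hausdorff_premeasure_le_measure) simp
  finally show ?thesis using c less_le_trans[of 0 "ennreal c"] by simp
qed

lemma inner_sum_orthonormal:
  assumes "dual_family n e e"
  shows "(\<Sum>i<n. a i *\<^sub>R e i) \<bullet> (\<Sum>i<n. a i *\<^sub>R e i) = (\<Sum>i<n. (a i)\<^sup>2)"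
proof -
  have "(\<Sum>i<n. a i *\<^sub>R e i) \<bullet> (\<Sum>i<n. a i *\<^sub>R e i) = (\<Sum>j<n. a j * ((\<Sum>i<n. a i *\<^sub>R e i) \<bullet> e j))"
    by (subst inner_sum_right) simp
  also have "\<dots> = (\<Sum>j<n. a j * a j)"
    using inner_dual_family[OF assms] by (intro sum.cong) auto
  finally show ?thesis by (simp add: power2_eq_square)
qed

text \<open>Carrying coordinates over from e to e' is isometric on the span of e.\<close>

lemma hausdorff_measure_orthonormal_unique:
  fixes e :: "nat \<Rightarrow> 'a::real_inner" and e' :: "nat \<Rightarrow> 'b::real_inner"
  assumes n: "0 < n" and e: "dual_family n e e" and e': "dual_family n e' e'"
  shows "hausdorff_measure n (half_open_parallelepiped n e) = hausdorff_measure n (half_open_parallelepiped n e')"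
proof -
  define f where "f x = (\<Sum>i<n. (x \<bullet> e i) *\<^sub>R e' i)" for x
  have f: "f (\<Sum>i<n. \<alpha> i *\<^sub>R e i) = (\<Sum>i<n. \<alpha> i *\<^sub>R e' i)" for \<alpha>
    unfolding f_def using inner_dual_family[OF e] by (intro sum.cong) auto
  have "half_open_parallelepiped n e' = f ` half_open_parallelepiped n e"
    unfolding half_open_parallelepiped_def by (auto simp: f image_iff) (use f in \<open>metis f\<close>)+
  moreover have "hausdorff_measure n (f ` half_open_parallelepiped n e) = hausdorff_measure n (half_open_parallelepiped n e)"
  proof (rule hausdorff_measure_isometric_image[OF n])
    fix x y assume "x \<in> half_open_parallelepiped n e" "y \<in> half_open_parallelepiped n e"
    then obtain \<alpha> \<beta> where x: "x = (\<Sum>i<n. \<alpha> i *\<^sub>R e i)" and y: "y = (\<Sum>i<n. \<beta> i *\<^sub>R e i)"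
      unfolding half_open_parallelepiped_def by blast
    have "x - y = (\<Sum>i<n. (\<alpha> i - \<beta> i) *\<^sub>R e i)" "f x - f y = (\<Sum>i<n. (\<alpha> i - \<beta> i) *\<^sub>R e' i)"
      unfolding x y f by (simp_all add: scaleR_left_diff_distrib sum_subtractf)
    then show "dist (f x) (f y) = dist x y"
      by (simp add: dist_norm norm_eq_sqrt_inner inner_sum_orthonormal e e')
  qed
  ultimately show ?thesis by simp
qed

section \<open>Gram determinants\<close>

text \<open>These matrices carry their dimension as a term and not in the type, so n can vary along
  inductions and with the length of a cycle.\<close>

definition gram_det :: "nat \<Rightarrow> (nat \<Rightarrow> 'a::real_inner) \<Rightarrow> real" where
  "gram_det n v = Determinant.det (Matrix.mat n n (\<lambda>(i, j). v i \<bullet> v j))"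

text \<open>The Gram matrix undergoes a row operation followed by the same column operation. The
  column operation is done as a row operation on the transpose, through the mixed matrix
  \<open>?G v u\<close>.\<close>

lemma gram_det_shear:
  fixes v :: "nat \<Rightarrow> 'a::real_inner"
  assumes "i < n" "j < n" "i \<noteq> j"
  shows "gram_det n (v(j := v j + t *\<^sub>R v i)) = gram_det n v"
proof -
  define u where "u = v(j := v j + t *\<^sub>R v i)"
  let ?G = "\<lambda>a b :: nat \<Rightarrow> 'a. Matrix.mat n n (\<lambda>(i, j). a i \<bullet> b j)"
  have "?G u u = addrow t j i (?G v u)"
    by (rule eq_matI) (use assms in \<open>auto simp: u_def mat_addrow_gen_def inner_add_left\<close>)
  moreover have "transpose_mat (?G v u) = addrow t j i (?G v v)"
    by (rule eq_matI) (use assms in \<open>auto simp: u_def mat_addrow_gen_def inner_add_left inner_add_right inner_commute\<close>)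
  ultimately have "Determinant.det (?G u u) = Determinant.det (?G v v)"
    using assms by (metis det_addrow det_transpose mat_carrier)
  then show ?thesis by (simp add: gram_det_def u_def)
qed

lemma gram_det_scale:
  fixes v :: "nat \<Rightarrow> 'a::real_inner"
  assumes "j < n"
  shows "gram_det n (v(j := s *\<^sub>R v j)) = s\<^sup>2 * gram_det n v"
proof -
  define u where "u = v(j := s *\<^sub>R v j)"
  let ?G = "\<lambda>a b :: nat \<Rightarrow> 'a. Matrix.mat n n (\<lambda>(i, j). a i \<bullet> b j)"
  have "?G u u = multrow j s (?G v u)"
    by (rule eq_matI) (use assms in \<open>auto simp: u_def mat_multrow_gen_def\<close>)
  moreover have "transpose_mat (?G v u) = multrow j s (?G v v)"
    by (rule eq_matI) (use assms in \<open>auto simp: u_def mat_multrow_gen_def inner_commute\<close>)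
  ultimately have "Determinant.det (?G u u) = s * (s * Determinant.det (?G v v))"
    using assms by (metis det_multrow det_transpose mat_carrier)
  then show ?thesis by (simp add: gram_det_def u_def power2_eq_square)
qed

lemma gram_det_orthonormal:
  assumes "dual_family n e e"
  shows "gram_det n e = 1"
proof -
  have "Matrix.mat n n (\<lambda>(i, j). e i \<bullet> e j) = 1\<^sub>m n"
    by (rule eq_matI) (use assms in \<open>auto simp: dual_family_def\<close>)
  then show ?thesis by (simp add: gram_det_def)
qed

lemma gram_det_eq_0:
  fixes v :: "nat \<Rightarrow> 'a::real_inner"
  assumes "\<not> linearly_independent_family n v"
  shows "gram_det n v = 0"
proof -
  obtain j where j: "j < n" "v j \<in> span (v ` ({..<n} - {j}))"
    using assms by (auto simp: linearly_independent_family_iff)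
  have "gram_det n (v(j := v j + w)) = gram_det n v" if "w \<in> span (v ` ({..<n} - {j}))" for w
    using that
  proof (induction rule: span_induct_alt)
    case (step c x y)
    then obtain i where i: "i < n" "i \<noteq> j" "x = v i" by auto
    let ?v = "v(j := v j + y)"
    have "v(j := v j + (c *\<^sub>R x + y)) = ?v(j := ?v j + c *\<^sub>R ?v i)"
      using i by (auto simp: fun_eq_iff)
    then show ?case
      using gram_det_shear[OF i(1) j(1) i(2), of ?v c] step.IH by metis
  qed simp
  \<comment> \<open>Shears by the other vectors replace the dependent vector by 0, after which
    scaling by the factor 0 gives determinant 0.\<close>
  then have "gram_det n (v(j := v j + - v j)) = gram_det n v"
    using j(2) span_neg by blast
  moreover have "gram_det n (v(j := 0 *\<^sub>R v j)) = 0"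
    by (simp add: gram_det_scale j(1) del: scaleR_zero_left)
  ultimately show ?thesis by simp
qed

section \<open>Gram-Schmidt and the comparison of volumes with Gram determinants\<close>

lemma orthogonalize_against:
  fixes v :: "nat \<Rightarrow> 'a::real_inner"
  assumes d: "dual_family n v d" and m: "m < n" and orth: "dual_family m v v" and "l \<le> m"
  shows "\<exists>u d. dual_family n u d \<and> gram_det n u = gram_det n v \<and>
    hausdorff_measure n (half_open_parallelepiped n u) = hausdorff_measure n (half_open_parallelepiped n v) \<and>
    (\<forall>k. k \<noteq> m \<longrightarrow> u k = v k) \<and> (\<forall>i<l. u m \<bullet> v i = 0)"
  using \<open>l \<le> m\<close>
proof (induction l)
  case 0
  then show ?case using d by auto
next
  case (Suc l)
  then obtain u :: "nat \<Rightarrow> 'a" and d' where u: "dual_family n u d'" "gram_det n u = gram_det n v"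
    "hausdorff_measure n (half_open_parallelepiped n u) = hausdorff_measure n (half_open_parallelepiped n v)"
    "\<forall>k. k \<noteq> m \<longrightarrow> u k = v k" "\<forall>i<l. u m \<bullet> v i = 0"
    by auto
  have l: "l < n" "m < n" "l \<noteq> m" and ul: "u l = v l" using Suc.prems m u(4) by auto
  \<comment> \<open>No normalising denominator appears because \<open>v l\<close> already has norm
    1.\<close>
  define t where "t = - (u m \<bullet> v l)"
  let ?u = "u(m := u m + t *\<^sub>R u l)"
  have "?u m \<bullet> v i = 0" if "i < Suc l" for i
  proof -
    have "v l \<bullet> v i = (if l = i then 1 else 0)"
      using orth that Suc.prems by (simp add: dual_family_def)
    then show ?thesis
      using u(5) that by (cases "i = l") (simp_all add: ul t_def inner_diff_left)
  qed
  moreover have "\<forall>k. k \<noteq> m \<longrightarrow> ?u k = v k" using u(4) by simp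
  ultimately show ?case
    using dual_family_shear[OF u(1) l, of t] gram_det_shear[OF l, of u t] hausdorff_measure_shear[OF u(1) l, of t] u(2,3)
    by metis
qed

text \<open>Shears leave both quantities alone, so c is the product of the norms divided out along
  the way. It enters the measure linearly and the Gram determinant squared.\<close>

lemma gram_schmidt:
  fixes v :: "nat \<Rightarrow> 'a::real_inner"
  assumes "dual_family n v d" "m \<le> n"
  shows "\<exists>(u :: nat \<Rightarrow> 'a) d c. dual_family n u d \<and> dual_family m u u \<and> 0 < c \<and> gram_det n v = c\<^sup>2 * gram_det n u \<and>
    hausdorff_measure n (half_open_parallelepiped n v) = ennreal c * hausdorff_measure n (half_open_parallelepiped n u)"
  using assms(2)
proof (induction m)
  case 0
  show ?case
    by (rule exI[of _ v], rule exI[of _ d], rule exI[of _ "1::real"])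
      (use assms(1) in \<open>auto simp: dual_family_def\<close>)
next
  case (Suc m)
  then have "m \<le> n" by simp
  from Suc.IH[OF this] obtain u :: "nat \<Rightarrow> 'a" and d' c where u: "dual_family n u d'" "dual_family m u u" "0 < c"
    "gram_det n v = c\<^sup>2 * gram_det n u"
    "hausdorff_measure n (half_open_parallelepiped n v) = ennreal c * hausdorff_measure n (half_open_parallelepiped n u)"
    by blast
  have m: "m < n" using Suc.prems by simp
  obtain w :: "nat \<Rightarrow> 'a" and d'' where w: "dual_family n w d''" "gram_det n w = gram_det n u"
    "hausdorff_measure n (half_open_parallelepiped n w) = hausdorff_measure n (half_open_parallelepiped n u)"
    "\<forall>k. k \<noteq> m \<longrightarrow> w k = u k" "\<forall>i<m. w m \<bullet> u i = 0"
    using orthogonalize_against[OF u(1) m u(2) order.refl] by blast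
  \<comment> \<open>Carrying the dual family through the induction guarantees that the residual
    vector can be normalised.\<close>
  have "w m \<bullet> d'' m = 1" using w(1) m by (simp add: dual_family_def)
  then have "w m \<noteq> 0" by auto
  then have r: "0 < norm (w m)" by simp
  define s where "s = 1 / norm (w m)"
  have s: "0 < s" "norm (w m) * s = 1" using r by (auto simp: s_def)
  define z where "z = w(m := s *\<^sub>R w m)"
  define z' where "z' = d''(m := d'' m /\<^sub>R s)"
  have "(s * norm (w m))\<^sup>2 = 1" using s(2) by (simp add: mult.commute)
  then have "s * (s * (w m \<bullet> w m)) = 1"
    by (simp add: power_mult_distrib power2_norm_eq_inner mult.assoc power2_eq_square[of s])
  then have orth: "dual_family (Suc m) z z"
    using u(2) w(4,5) by (auto simp: z_def dual_family_def less_Suc_eq inner_commute)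
  have "gram_det n v = (c * norm (w m))\<^sup>2 * gram_det n z"
    using s u(4) w(2) by (simp add: z_def gram_det_scale m power_mult_distrib[symmetric] mult.assoc[symmetric])
      (simp add: mult.assoc)
  moreover have "ennreal (c * norm (w m)) * (ennreal s * hausdorff_measure n (half_open_parallelepiped n w))
      = ennreal c * hausdorff_measure n (half_open_parallelepiped n u)"
    using s u(3) by (simp add: w(3) mult.assoc[symmetric] ennreal_mult[symmetric]) (simp add: mult.assoc)
  ultimately show ?case
    using dual_family_scale[OF w(1) m, of s, folded z_def z'_def] orth s r u(3,5) hausdorff_measure_scale[OF w(1) m s(1), folded z_def]
    by - (rule exI[of _ z], rule exI[of _ z'], rule exI[of _ "c * norm (w m)"], auto)
qed

lemma parallelepiped_volume_dependent:
  assumes "0 < n" "\<not> linearly_independent_family n v"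
  shows "parallelepiped_volume n v = 0"
proof -
  have "hausdorff_measure n {0::'a} \<le> 0"
  proof (rule hausdorff_measure_leI)
    fix \<delta> :: real assume "0 < \<delta>"
    then show "hausdorff_premeasure n \<delta> {0::'a} \<le> 0"
      using hausdorff_premeasure_finite_cover_le[of "{0::nat}" "{0::'a}" "\<lambda>_. {0}" \<delta> n] assms(1)
      by (simp add: hausdorff_weight_def power_0_left)
  qed
  then show ?thesis
    using assms(2) by (simp add: parallelepiped_volume_def parallelepiped_def)
qed

lemma parallelepiped_volume_independent:
  fixes v :: "nat \<Rightarrow> 'a::real_inner"
  assumes "0 < n" "linearly_independent_family n v"
  obtains e :: "nat \<Rightarrow> 'a" and c where "dual_family n e e" "0 < c" "gram_det n v = c\<^sup>2"
    "parallelepiped_volume n v = ennreal c * hausdorff_measure n (half_open_parallelepiped n e)"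
proof -
  obtain d where "dual_family n v d"
    using assms(2) dual_family_exists_iff by blast
  from gram_schmidt[OF this order.refl] obtain u :: "nat \<Rightarrow> 'a" and c
    where u: "dual_family n u u" "0 < c" "gram_det n v = c\<^sup>2 * gram_det n u"
      "hausdorff_measure n (half_open_parallelepiped n v) = ennreal c * hausdorff_measure n (half_open_parallelepiped n u)"
    by blast
  then show thesis
    using that[of u c] parallelepiped_volume_eq_half_open[OF assms] by (simp add: gram_det_orthonormal)
qed

text \<open>Zero volume detects dependence, so v and w are both dependent or both independent. In
  the second case the volumes are c and c' times the same positive finite constant h, which
  cancels.\<close>

lemma gram_det_eq_of_volume_eq:
  fixes v w :: "nat \<Rightarrow> 'a::real_inner"
  assumes n: "0 < n" and eq: "parallelepiped_volume n v = parallelepiped_volume n w"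
  shows "gram_det n v = gram_det n w"
proof -
  have pos: "0 < parallelepiped_volume n u" if u: "linearly_independent_family n u" for u :: "nat \<Rightarrow> 'a"
  proof -
    obtain e :: "nat \<Rightarrow> 'a" and c where "dual_family n e e" "0 < c" "gram_det n u = c\<^sup>2"
      "parallelepiped_volume n u = ennreal c * hausdorff_measure n (half_open_parallelepiped n e)"
      by (rule parallelepiped_volume_independent[OF n u])
    then show ?thesis
      using hausdorff_measure_orthonormal_pos[OF n, of e] by (simp add: ennreal_zero_less_mult_iff)
  qed
  consider "linearly_independent_family n v" "linearly_independent_family n w"
    | "\<not> linearly_independent_family n v" "\<not> linearly_independent_family n w"
    using pos parallelepiped_volume_dependent[OF n] eq less_irrefl by metis
  then show ?thesis
  proof cases
    case 1
    obtain e :: "nat \<Rightarrow> 'a" and c where e: "dual_family n e e" "0 < c" "gram_det n v = c\<^sup>2"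
      "parallelepiped_volume n v = ennreal c * hausdorff_measure n (half_open_parallelepiped n e)"
      by (rule parallelepiped_volume_independent[OF n 1(1)])
    obtain e' :: "nat \<Rightarrow> 'a" and c' where e': "dual_family n e' e'" "0 < c'" "gram_det n w = c'\<^sup>2"
      "parallelepiped_volume n w = ennreal c' * hausdorff_measure n (half_open_parallelepiped n e')"
      by (rule parallelepiped_volume_independent[OF n 1(2)])
    obtain h where h: "hausdorff_measure n (half_open_parallelepiped n e) = ennreal h" "0 < h"
      using hausdorff_measure_half_open_parallelepiped_finite[OF n, of e]
        hausdorff_measure_orthonormal_pos[OF n e(1)]
      by (cases "hausdorff_measure n (half_open_parallelepiped n e)") auto
    have "ennreal (c * h) = ennreal (c' * h)"
      using eq e(2,4) e'(2,4) h hausdorff_measure_orthonormal_unique[OF n e(1) e'(1)]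
      by (simp add: ennreal_mult)
    then show ?thesis
      using e(2,3) e'(2,3) h by simp
  next
    case 2
    then show ?thesis by (simp add: gram_det_eq_0)
  qed
qed

section \<open>Leibniz expansion of cyclic band Gram matrices\<close>

lemma gram_det_leibniz:
  "gram_det n v = (\<Sum>p | p permutes {0..<n}. of_int (sign p) * (\<Prod>i = 0..<n. v i \<bullet> v (p i)))"
proof -
  have "(\<Prod>i = 0..<n. Matrix.mat n n (\<lambda>(i, j). v i \<bullet> v j) $$ (i, p i)) = (\<Prod>i = 0..<n. v i \<bullet> v (p i))"
    if "p permutes {0..<n}" for p
    using permutes_in_image[OF that] by (intro prod.cong) auto
  then show ?thesis
    unfolding gram_det_def by (subst det_def') (auto intro!: sum.cong)
qed

lemma gram_det_1: "gram_det 1 v = v 0 \<bullet> v 0"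
  unfolding gram_det_def by (subst det_single) auto

lemma gram_det_2: "gram_det 2 v = (v 0 \<bullet> v 0) * (v 1 \<bullet> v 1) - (v 0 \<bullet> v 1)\<^sup>2"
proof -
  have *: "{0..<2} = {0, 1::nat}" by auto
  have "{p. p permutes {0, 1::nat}} = {id, Transposition.transpose 0 1}"
    by (auto simp: permutes_doubleton_iff)
  moreover have "id \<noteq> Transposition.transpose 0 (1::nat)"
    by (metis id_apply transpose_apply_first zero_neq_one)
  ultimately show ?thesis
    unfolding gram_det_leibniz *
    by (simp add: sign_swap_id sign_id inner_commute power2_eq_square)
qed

text \<open>The cycle through 0, ..., k in order; its Leibniz term multiplies the inner products
  once around a chordless cycle of the graph.\<close>

definition rotation :: "nat \<Rightarrow> nat \<Rightarrow> nat" where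
  "rotation k i = (if i < k then Suc i else if i = k then 0 else i)"

lemma rotation_permutes: "rotation k permutes {0..<Suc k}"
proof (rule bij_imp_permutes)
  have "inj_on (rotation k) {0..<Suc k}"
    by (auto simp: inj_on_def rotation_def split: if_splits)
  moreover have "rotation k ` {0..<Suc k} \<subseteq> {0..<Suc k}"
    by (auto simp: rotation_def)
  ultimately show "bij_betw (rotation k) {0..<Suc k} {0..<Suc k}"
    by (simp add: bij_betw_def endo_inj_surj)
qed (simp add: rotation_def)

text \<open>The corner entries of a cyclic band matrix enter the Leibniz formula separately only through the
  two full rotations.\<close>

lemma permutes_cycle_rigid:
  assumes p: "p permutes {0..<Suc k}" and corner: "p 0 = k" "p k \<noteq> 0" "0 < k"
    and band: "\<And>i. i \<le> k \<Longrightarrow> p i = i \<or> p i = Suc i \<or> i = Suc (p i) \<or> i = 0 \<and> p i = k \<or> i = k \<and> p i = 0"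
  shows "p = Hilbert_Choice.inv (rotation k)"
proof -
  have inj: "p i = p j \<Longrightarrow> i = j" for i j
    using permutes_inj[OF p] by (simp add: inj_eq)
  have le: "p i \<le> k" if "i \<le> k" for i
    using permutes_in_image[OF p, of i] that by auto
  \<comment> \<open>Downward induction on i: the values that would keep Suc i fixed or move it up
    are already taken, by 0 if the value is k and otherwise by the next larger index.\<close>
  have "p (Suc i) = i" if "i < k" for i
    using that
  proof (induction "k - i" arbitrary: i rule: less_induct)
    case less
    have IH: "p (Suc l) = l" if "i < l" "l < k" for l
      using less.hyps[of l] that by auto
    have "p (Suc i) \<noteq> Suc i"
    proof
      assume eq: "p (Suc i) = Suc i"
      show False
      proof (cases "Suc i = k")
        case True
        then show False using eq corner inj[of 0 "Suc i"] by auto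
      next
        case False
        then have "p (Suc (Suc i)) = Suc i" using IH less.prems by auto
        then show False using eq inj[of "Suc (Suc i)" "Suc i"] by auto
      qed
    qed
    moreover have "p (Suc i) \<noteq> Suc (Suc i)"
    proof
      assume eq: "p (Suc i) = Suc (Suc i)"
      then have "Suc (Suc i) \<le> k" using le[of "Suc i"] less.prems by simp
      show False
      proof (cases "Suc (Suc i) = k")
        case True
        then show False using eq corner inj[of 0 "Suc i"] by auto
      next
        case False
        then have "p (Suc (Suc (Suc i))) = Suc (Suc i)" using IH \<open>Suc (Suc i) \<le> k\<close> by auto
        then show False using eq inj[of "Suc (Suc (Suc i))" "Suc i"] by auto
      qed
    qed
    moreover have "\<not> (Suc i = k \<and> p (Suc i) = 0)" using corner by auto
    ultimately show ?case using band[of "Suc i"] less.prems by auto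
  qed
  then have "p (rotation k i) = i" for i
    using corner permutes_not_in[OF p, of i] by (auto simp: rotation_def)
  then have "p \<circ> rotation k = id" by (auto simp: fun_eq_iff)
  then have "p \<circ> rotation k \<circ> Hilbert_Choice.inv (rotation k) = Hilbert_Choice.inv (rotation k)" by simp
  then show ?thesis
    using permutes_surj[OF rotation_permutes, of k] by (simp add: comp_assoc surj_iff)
qed

text \<open>A Leibniz term using neither corner is unaffected, and in one using both the sign
  changes cancel. A nonzero term using exactly one corner belongs to the full rotation or its
  inverse; these two give equal nonzero contributions to the difference.\<close>

lemma gram_det_flip_corner:
  fixes v :: "nat \<Rightarrow> 'a::real_inner" and w :: "nat \<Rightarrow> 'b::real_inner"
  assumes k: "2 \<le> k"
    and same: "\<And>i j. i \<le> j \<Longrightarrow> j \<le> k \<Longrightarrow> (i, j) \<noteq> (0, k) \<Longrightarrow> w i \<bullet> w j = v i \<bullet> v j"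
    and corner: "w 0 \<bullet> w k = - (v 0 \<bullet> v k)" "v 0 \<bullet> v k \<noteq> 0"
    and adj: "\<And>i. i < k \<Longrightarrow> v i \<bullet> v (Suc i) \<noteq> 0"
    and chordless: "\<And>i j. Suc i < j \<Longrightarrow> j \<le> k \<Longrightarrow> (i, j) \<noteq> (0, k) \<Longrightarrow> v i \<bullet> v j = 0"
  shows "gram_det (Suc k) v \<noteq> gram_det (Suc k) w"
proof -
  define a where "a i j = v i \<bullet> v j" for i j
  define b where "b i j = w i \<bullet> w j" for i j
  define N where "N = {0..<Suc k}"
  define r where "r = rotation k"
  have a_sym: "a i j = a j i" and b_sym: "b i j = b j i" for i j
    by (simp_all add: a_def b_def inner_commute)
  have ab: "b i j = a i j" if "i \<le> k" "j \<le> k" "(i, j) \<noteq> (0, k)" "(i, j) \<noteq> (k, 0)" for i j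
    using same[of i j] same[of j i] that a_sym[of i j] b_sym[of i j]
    by (cases "i \<le> j") (auto simp: a_def b_def)
  have ab_corner: "b 0 k = - a 0 k" "b k 0 = - a k 0"
    using corner(1) a_sym b_sym by (simp_all add: a_def b_def inner_commute)
  have band: "j = i \<or> j = Suc i \<or> i = Suc j \<or> i = 0 \<and> j = k \<or> i = k \<and> j = 0"
    if "a i j \<noteq> 0" "i \<le> k" "j \<le> k" for i j
  proof (cases "i \<le> j")
    case True
    then show ?thesis using chordless[of i j] that by (fastforce simp: a_def)
  next
    case False
    then show ?thesis using chordless[of j i] that by (fastforce simp: a_def inner_commute[of "v i"])
  qed
  define f where "f p = of_int (sign p) * ((\<Prod>i\<in>N. a i (p i)) - (\<Prod>i\<in>N. b i (p i)))" for p
  have fin_N: "finite N" by (simp add: N_def)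
  have r: "r permutes N" unfolding r_def N_def by (rule rotation_permutes)
  have rigid: "p = Hilbert_Choice.inv r" if p: "p permutes N" "p 0 = k" "p k \<noteq> 0" "\<forall>i\<in>N. a i (p i) \<noteq> 0" for p
    unfolding r_def
  proof (rule permutes_cycle_rigid)
    fix i assume "i \<le> k"
    then show "p i = i \<or> p i = Suc i \<or> i = Suc (p i) \<or> i = 0 \<and> p i = k \<or> i = k \<and> p i = 0"
      using p(4) permutes_in_image[OF p(1), of i] by (intro band) (auto simp: N_def)
  qed (use p k in \<open>auto simp: N_def\<close>)
  have f0: "f p = 0" if p: "p permutes N" "p \<noteq> r" "p \<noteq> Hilbert_Choice.inv r" for p
  proof (rule ccontr)
    assume "f p \<noteq> 0"
    then have ne: "(\<Prod>i\<in>N. a i (p i)) \<noteq> (\<Prod>i\<in>N. b i (p i))" by (auto simp: f_def)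
    have pN: "p i \<le> k" if "i \<le> k" for i
      using permutes_in_image[OF p(1), of i] that by (auto simp: N_def)
    \<comment> \<open>Sign changes do not affect vanishing, so a permutation whose two products
      differ runs through nonzero entries only.\<close>
    have "a i (p i) = 0 \<longleftrightarrow> b i (p i) = 0" if "i \<in> N" for i
      using ab[of i "p i"] ab_corner pN[of i] that by (cases "(i, p i) \<in> {(0, k), (k, 0)}") (auto simp: N_def)
    then have zero: "(\<Prod>i\<in>N. a i (p i)) = 0 \<longleftrightarrow> (\<Prod>i\<in>N. b i (p i)) = 0"
      unfolding prod_zero_iff[OF fin_N] by blast
    then have nz: "\<forall>i\<in>N. a i (p i) \<noteq> 0"
      using ne prod_zero_iff[OF fin_N, of "\<lambda>i. a i (p i)"] by metis
    have rest: "(\<Prod>i\<in>N - M. a i (p i)) = (\<Prod>i\<in>N - M. b i (p i))"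
      if M: "p 0 = k \<Longrightarrow> 0 \<in> M" "p k = 0 \<Longrightarrow> k \<in> M" for M
    proof (intro prod.cong refl)
      fix i assume i: "i \<in> N - M"
      then have "(i, p i) \<noteq> (0, k)" "(i, p i) \<noteq> (k, 0)" using M by auto
      then show "a i (p i) = b i (p i)" using ab[of i "p i"] pN[of i] i by (simp add: N_def)
    qed
    consider "p 0 = k" "p k = 0" | "p 0 = k" "p k \<noteq> 0" | "p 0 \<noteq> k" "p k = 0" | "p 0 \<noteq> k" "p k \<noteq> 0"
      by blast
    then show False
    proof cases
      case 1
      have "(\<Prod>i\<in>N. c i (p i)) = c 0 (p 0) * (c k (p k) * (\<Prod>i\<in>N - {0} - {k}. c i (p i)))" for c :: "nat \<Rightarrow> nat \<Rightarrow> real"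
      proof -
        have "0 \<in> N" "k \<in> N - {0}" using k by (auto simp: N_def)
        then show ?thesis
          using prod.remove[OF fin_N, of 0 "\<lambda>i. c i (p i)"] prod.remove[of "N - {0}" k "\<lambda>i. c i (p i)"] fin_N
          by simp
      qed
      moreover have "N - {0} - {k} = N - {0, k}" by auto
      ultimately show False using ne rest[of "{0, k}"] ab_corner 1 by simp
    next
      case 2
      then show False using rigid[OF p(1)] nz p(3) by blast
    next
      case 3
      \<comment> \<open>By symmetry of the matrix, the inverse permutation uses the opposite corner,
        which reduces this case to the rigid one.\<close>
      have pi: "Hilbert_Choice.inv p permutes N" using permutes_inv[OF p(1)] .
      have inv_p: "p (Hilbert_Choice.inv p i) = i" "Hilbert_Choice.inv p (p i) = i" for i
        using permutes_inverses[OF p(1)] by simp_all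
      have "Hilbert_Choice.inv p = Hilbert_Choice.inv r"
      proof (rule rigid[OF pi])
        show "Hilbert_Choice.inv p 0 = k" using inv_p(2)[of k] 3 by simp
        show "Hilbert_Choice.inv p k \<noteq> 0" using inv_p(1)[of k] 3(1) by metis
        show "\<forall>i\<in>N. a i (Hilbert_Choice.inv p i) \<noteq> 0"
        proof
          fix i assume "i \<in> N"
          then have "Hilbert_Choice.inv p i \<in> N" using permutes_in_image[OF pi] by simp
          then have "a (Hilbert_Choice.inv p i) (p (Hilbert_Choice.inv p i)) \<noteq> 0" using nz by blast
          then show "a i (Hilbert_Choice.inv p i) \<noteq> 0" by (simp add: inv_p a_sym[of i])
        qed
      qed
      then have "p = r" using permutes_inv_inv[OF p(1)] permutes_inv_inv[OF r] by metis
      then show False using p(2) by simp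
    next
      case 4
      then show False using ne rest[of "{}"] by simp
    qed
  qed
  have r_vals: "r k = 0" "\<And>i. i < k \<Longrightarrow> r i = Suc i" by (simp_all add: r_def rotation_def)
  have inv_r: "Hilbert_Choice.inv r 0 = k" using r_vals(1) permutes_inverses(2)[OF r, of k] by simp
  then have r_ne: "r \<noteq> Hilbert_Choice.inv r" using r_vals(2)[of 0] k by auto
  have f_inv: "f (Hilbert_Choice.inv r) = f r"
  proof -
    have "(\<Prod>i\<in>N. c i (Hilbert_Choice.inv r i)) = (\<Prod>i\<in>N. c i (r i))" if c: "\<And>i j. c i j = c j i" for c :: "nat \<Rightarrow> nat \<Rightarrow> real"
    proof -
      have "(\<Prod>i\<in>N. c i (Hilbert_Choice.inv r i)) = (\<Prod>i\<in>N. c (r i) (Hilbert_Choice.inv r (r i)))"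
        using r by (rule prod.permute[of r N "\<lambda>i. c i (Hilbert_Choice.inv r i)", unfolded comp_def])
      also have "\<dots> = (\<Prod>i\<in>N. c (r i) i)" using permutes_inverses(2)[OF r] by simp
      also have "\<dots> = (\<Prod>i\<in>N. c i (r i))" by (intro prod.cong refl c)
      finally show ?thesis .
    qed
    moreover have "sign (Hilbert_Choice.inv r) = sign r"
      using r by (intro sign_inverse) (auto simp: permutation_permutes N_def)
    ultimately show ?thesis using a_sym b_sym by (simp add: f_def)
  qed
  have "f r \<noteq> 0"
  proof -
    have split: "(\<Prod>i\<in>N. c i (r i)) = (\<Prod>i<k. c i (Suc i)) * c k 0" for c :: "nat \<Rightarrow> nat \<Rightarrow> real"
      using r_vals by (simp add: N_def atLeast0LessThan)
    have "(\<Prod>i<k. b i (Suc i)) = (\<Prod>i<k. a i (Suc i))"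
      using k by (intro prod.cong ab) auto
    \<comment> \<open>The rotation meets one corner, so its product changes sign and the difference
      is twice the original product.\<close>
    then have "f r = of_int (sign r) * (2 * ((\<Prod>i<k. a i (Suc i)) * a k 0))"
      unfolding f_def split ab_corner by simp
    moreover have "(\<Prod>i<k. a i (Suc i)) \<noteq> 0" using adj by (simp add: a_def)
    moreover have "a k 0 \<noteq> 0" using corner(2) by (simp add: a_def inner_commute)
    ultimately show ?thesis by (simp add: sign_def)
  qed
  have "gram_det (Suc k) v - gram_det (Suc k) w = (\<Sum>p | p permutes N. f p)"
    unfolding gram_det_leibniz f_def N_def a_def b_def by (simp add: right_diff_distrib sum_subtractf)
  also have "\<dots> = (\<Sum>p\<in>{r, Hilbert_Choice.inv r}. f p)"
    using f0 r permutes_inv[OF r] finite_permutations[of N]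
    by (intro sum.mono_neutral_right) (auto simp: N_def)
  also have "\<dots> = 2 * f r"
    using r_ne f_inv by simp
  finally show ?thesis using \<open>f r \<noteq> 0\<close> by auto
qed

section \<open>Inner products and the isometry\<close>

lemma inner_preserving_extends_to_isometry:
  fixes \<Phi> :: "'a::{real_inner, complete_space} \<Rightarrow> 'a"
  assumes dense: "closure (span B) = UNIV"
    and inner: "\<And>x y. x \<in> B \<Longrightarrow> y \<in> B \<Longrightarrow> \<Phi> x \<bullet> \<Phi> y = x \<bullet> y"
  shows "\<exists>T. linear_isometry T \<and> (\<forall>x\<in>B. T x = \<Phi> x)"
proof -
  define G where "G = span ((\<lambda>x. (x, \<Phi> x)) ` B)"
  have inner_B: "\<Phi> x \<bullet> snd p = x \<bullet> fst p" if "p \<in> G" "x \<in> B" for p x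
    using that(1) unfolding G_def
    by (induction rule: span_induct_alt) (auto simp: inner that inner_add_right)
  have inner_G: "snd q \<bullet> snd p = fst q \<bullet> fst p" if "p \<in> G" "q \<in> G" for p q
    using that(2) unfolding G_def
    by (induction rule: span_induct_alt) (auto simp: inner_B that inner_add_left)
  have norm_G: "norm (fst p) = norm (snd p)" if "p \<in> G" for p
    using inner_G[OF that that] by (simp add: norm_eq_sqrt_inner)
  have "closed {p :: 'a \<times> 'a. norm (fst p) = norm (snd p)}"
    by (intro closed_Collect_eq continuous_intros)
  then have "closure G \<subseteq> {p. norm (fst p) = norm (snd p)}"
    using norm_G by (intro closure_minimal) auto
  \<comment> \<open>Equality of norms survives in the closure. Applied to a difference with first
    component 0, it makes the closed graph single-valued.\<close>
  then have norm_eq: "norm x = norm y" if "(x, y) \<in> closure G" for x y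
    using that by auto
  have add: "p + q \<in> closure G" if pq: "p \<in> closure G" "q \<in> closure G" for p q
  proof -
    obtain f g where "\<forall>n. f n \<in> G" "f \<longlonglongrightarrow> p" "\<forall>n. g n \<in> G" "g \<longlonglongrightarrow> q"
      using pq unfolding closure_sequential by blast
    then have "\<forall>n. f n + g n \<in> G" "(\<lambda>n. f n + g n) \<longlonglongrightarrow> p + q"
      by (auto simp: G_def intro: span_add tendsto_add)
    then show ?thesis unfolding closure_sequential by (intro exI[of _ "\<lambda>n. f n + g n"] conjI)
  qed
  have scale: "c *\<^sub>R p \<in> closure G" if p: "p \<in> closure G" for c p
  proof -
    obtain f where "\<forall>n. f n \<in> G" "f \<longlonglongrightarrow> p"
      using p unfolding closure_sequential by blast
    then have "\<forall>n. c *\<^sub>R f n \<in> G" "(\<lambda>n. c *\<^sub>R f n) \<longlonglongrightarrow> c *\<^sub>R p"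
      by (auto simp: G_def intro: span_scale tendsto_intros)
    then show ?thesis unfolding closure_sequential by (intro exI[of _ "\<lambda>n. c *\<^sub>R f n"] conjI)
  qed
  have unique: "y = y'" if "(x, y) \<in> closure G" "(x, y') \<in> closure G" for x y y'
  proof -
    have "(x, y) + (- 1) *\<^sub>R (x, y') \<in> closure G" by (intro add scale that)
    then show ?thesis using norm_eq[of 0 "y - y'"] by simp
  qed
  have "\<exists>y. (x, y) \<in> closure G" for x
  proof -
    have "x \<in> closure (span B)" using dense by simp
    then obtain s where s: "\<forall>n. s n \<in> span B" "s \<longlonglongrightarrow> x"
      unfolding closure_sequential by blast
    have "span (fst ` (\<lambda>x. (x, \<Phi> x)) ` B) = fst ` G"
      unfolding G_def by (rule linear_span_image[OF linear_fst])
    then have "span B = fst ` G" by (simp add: image_image)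
    then have "\<forall>n. \<exists>p. p \<in> G \<and> fst p = s n" using s(1) by (metis imageE)
    then obtain g where g: "\<forall>n. g n \<in> G \<and> fst (g n) = s n" by metis
    \<comment> \<open>Differences of points of G also lie in G, so the second components form a
      Cauchy sequence whenever the first ones do; completeness then makes the closed graph
      total.\<close>
    have d: "dist (snd (g m)) (snd (g n)) = dist (s m) (s n)" for m n
    proof -
      have "g m - g n \<in> G" using g unfolding G_def by (intro span_diff) auto
      from norm_G[OF this] show ?thesis using g by (simp add: dist_norm)
    qed
    have "Cauchy (\<lambda>n. snd (g n))"
      using LIMSEQ_imp_Cauchy[OF s(2)] by (simp add: Cauchy_def d)
    then obtain y where y: "(\<lambda>n. snd (g n)) \<longlonglongrightarrow> y"
      by (auto simp: Cauchy_convergent_iff convergent_def)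
    have "(\<lambda>n. (s n, snd (g n))) \<longlonglongrightarrow> (x, y)"
      by (intro tendsto_Pair s(2) y)
    moreover have "(s n, snd (g n)) \<in> G" for n
      using g by (metis prod.collapse)
    ultimately have "(x, y) \<in> closure G"
      unfolding closure_sequential by (intro exI[of _ "\<lambda>n. (s n, snd (g n))"] conjI allI)
    then show ?thesis ..
  qed
  then obtain T where T: "\<And>x. (x, T x) \<in> closure G" by metis
  have "linear T"
  proof (rule linearI)
    show "T (x + y) = T x + T y" for x y
      using unique[OF T, of "x + y" "T x + T y"] add[OF T[of x] T[of y]] by simp
    show "T (c *\<^sub>R x) = c *\<^sub>R T x" for c x
      using unique[OF T, of "c *\<^sub>R x" "c *\<^sub>R T x"] scale[OF T[of x], of c] by simp
  qed
  moreover have "norm (T x) = norm x" for x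
    using norm_eq[OF T[of x]] by simp
  moreover have "T x = \<Phi> x" if "x \<in> B" for x
  proof -
    have "(x, \<Phi> x) \<in> G" unfolding G_def using that by (intro span_base) auto
    then show ?thesis using unique[OF T] closure_subset by blast
  qed
  ultimately show ?thesis unfolding linear_isometry_def by blast
qed

section \<open>Weak topology and chains in connected sets\<close>

lemma topspace_weak_topology [simp]: "topspace weak_topology = (UNIV :: 'a::real_normed_vector set)"
proof -
  have "(UNIV :: 'a set) \<in> {f -` U | (f :: 'a \<Rightarrow> real) U. bounded_linear f \<and> open U}"
    by (intro CollectI exI[of _ "\<lambda>_. 0"] exI[of _ UNIV]) auto
  then show ?thesis unfolding weak_topology_def topology_generated_by_topspace by blast
qed

lemma openin_weak_topology_inner_pos: "openin weak_topology {x :: 'a::real_inner. 0 < a \<bullet> x}"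
proof -
  have "{x. 0 < a \<bullet> x} \<in> {f -` U | (f :: 'a \<Rightarrow> real) U. bounded_linear f \<and> open U}"
    by (intro CollectI exI[of _ "\<lambda>x. a \<bullet> x"] exI[of _ "{0<..}"])
      (auto intro: bounded_linear_inner_right)
  then show ?thesis unfolding weak_topology_def by (rule topology_generated_by_Basis)
qed

text \<open>The set reachable from x is open because each point is related to a whole neighbourhood;
  by symmetry of R so is its complement. Connectedness leaves only B itself.\<close>

lemma connectedin_rtrancl:
  assumes conn: "connectedin X B" and sym: "sym R"
    and nbhd: "\<And>x. x \<in> B \<Longrightarrow> \<exists>U. openin (subtopology X B) U \<and> x \<in> U \<and> (\<forall>y\<in>U. (x, y) \<in> R)"
    and xy: "x \<in> B" "y \<in> B"
  shows "(x, y) \<in> R\<^sup>*"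
proof -
  let ?S = "subtopology X B"
  define C where "C = {z \<in> B. (x, z) \<in> R\<^sup>*}"
  have top: "topspace ?S = B" using conn by (auto simp: connectedin_def)
  have "openin ?S C"
  proof (subst openin_subopen, intro ballI)
    fix z assume z: "z \<in> C"
    then obtain U where U: "openin ?S U" "z \<in> U" "\<forall>y\<in>U. (z, y) \<in> R"
      using nbhd[of z] by (auto simp: C_def)
    have "U \<subseteq> C"
      using U(3) z openin_subset[OF U(1)] unfolding top C_def by (auto intro: rtrancl_into_rtrancl)
    then show "\<exists>T. openin ?S T \<and> z \<in> T \<and> T \<subseteq> C" using U by blast
  qed
  moreover have "openin ?S (B - C)"
  proof (subst openin_subopen, intro ballI)
    fix z assume z: "z \<in> B - C"
    then obtain U where U: "openin ?S U" "z \<in> U" "\<forall>y\<in>U. (z, y) \<in> R"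
      using nbhd[of z] by auto
    have "U \<subseteq> B - C"
      using U(3) z openin_subset[OF U(1)] sym unfolding top C_def
      by (auto dest: symD intro: rtrancl_into_rtrancl)
    then show "\<exists>T. openin ?S T \<and> z \<in> T \<and> T \<subseteq> B - C" using U by blast
  qed
  ultimately have "C = {} \<or> C = B"
    using conn top unfolding connectedin_def connected_space_clopen_in closedin_def
    by (metis (no_types, lifting) C_def Collect_subset mem_Collect_eq subsetI)
  then show ?thesis using xy by (auto simp: C_def)
qed

text \<open>Here \<open>R\<close> is the relation of having the same nonzero inner product before and after \<open>\<Phi>\<close>. A pair with
  opposite inner products at minimal \<open>R\<close>-distance closes up to a chordless cycle whose Gram matrices
  differ only in the sign of the corner entries.\<close>

lemma inner_eq_of_gram_det_eq:
  fixes \<Phi> :: "'a::real_inner \<Rightarrow> 'b::real_inner"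
  assumes gram: "\<And>n v. 0 < n \<Longrightarrow> inj_on v {..<n} \<Longrightarrow> v ` {..<n} \<subseteq> B \<Longrightarrow> gram_det n v = gram_det n (\<Phi> \<circ> v)"
    and reach: "\<And>x y. x \<in> B \<Longrightarrow> y \<in> B \<Longrightarrow>
      (x, y) \<in> {(x, y) \<in> B \<times> B. x \<bullet> y \<noteq> 0 \<and> \<Phi> x \<bullet> \<Phi> y = x \<bullet> y}\<^sup>*"
    and nonzero: "0 \<notin> B"
    and norm_eq: "\<And>x. x \<in> B \<Longrightarrow> \<Phi> x \<bullet> \<Phi> x = x \<bullet> x"
    and abs_eq: "\<And>x y. x \<in> B \<Longrightarrow> y \<in> B \<Longrightarrow> \<bar>\<Phi> x \<bullet> \<Phi> y\<bar> = \<bar>x \<bullet> y\<bar>"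
    and xy: "x \<in> B" "y \<in> B"
  shows "\<Phi> x \<bullet> \<Phi> y = x \<bullet> y"
proof (rule ccontr)
  define R where "R = {(x, y) \<in> B \<times> B. x \<bullet> y \<noteq> 0 \<and> \<Phi> x \<bullet> \<Phi> y = x \<bullet> y}"
  define N where "N = {(x, y) \<in> B \<times> B. x \<bullet> y \<noteq> 0 \<and> \<Phi> x \<bullet> \<Phi> y = - (x \<bullet> y)}"
  have cases: "x \<bullet> y = 0 \<or> (x, y) \<in> R \<or> (x, y) \<in> N" if "x \<in> B" "y \<in> B" for x y
    using abs_eq[OF that] that by (auto simp: R_def N_def abs_eq_iff)
  have disj: "(x, y) \<notin> N" if "(x, y) \<in> R" for x y
    using that by (auto simp: R_def N_def)
  have refl: "(x, x) \<notin> N" for x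
    using norm_eq[of x] by (auto simp: N_def)
  define P where "P k \<longleftrightarrow> (\<exists>(x, y)\<in>N. (x, y) \<in> R ^^ k)" for k
  assume "\<Phi> x \<bullet> \<Phi> y \<noteq> x \<bullet> y"
  then have "(x, y) \<in> N" using abs_eq[OF xy] xy by (auto simp: N_def abs_eq_iff)
  moreover obtain k0 where "(x, y) \<in> R ^^ k0"
    using reach[OF xy] unfolding R_def[symmetric] by (auto dest: rtrancl_imp_relpow)
  ultimately have "P k0" unfolding P_def by blast
  define k where "k = (LEAST k. P k)"
  have "P k" unfolding k_def using \<open>P k0\<close> by (rule LeastI)
  have minimal: "\<not> P l" if "l < k" for l
    using that not_less_Least unfolding k_def by blast
  obtain f where f: "(f 0, f k) \<in> N" "\<And>i. i < k \<Longrightarrow> (f i, f (Suc i)) \<in> R"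
    using \<open>P k\<close> unfolding P_def relpow_fun_conv by auto
  have seg: "(f i, f (i + l)) \<in> R ^^ l" if "i + l \<le> k" for i l
    using that by (induction l) (use f(2) in \<open>auto intro: relcompI\<close>)
  \<comment> \<open>Replacing a segment of the minimal path by a shorter walk would join the same
    pair f 0, f k in fewer steps.\<close>
  have shortcut: "\<not> (f i, f j) \<in> R ^^ l" if "i \<le> j" "j \<le> k" "l < j - i" for i j l
  proof
    assume "(f i, f j) \<in> R ^^ l"
    moreover have "(f 0, f i) \<in> R ^^ i" using seg[of 0 i] that by simp
    moreover have "(f j, f k) \<in> R ^^ (k - j)" using seg[of j "k - j"] that by simp
    ultimately have "(f 0, f k) \<in> R ^^ (i + l + (k - j))"
      unfolding relpow_add by blast
    then have "P (i + l + (k - j))" using f(1) unfolding P_def by blast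
    then show False using minimal[of "i + l + (k - j)"] that by linarith
  qed
  have "k \<noteq> 0"
    using f(1) refl[of "f 0"] by (intro notI) simp
  moreover have "k \<noteq> 1"
    using f disj by (metis One_nat_def less_one)
  ultimately have k: "2 \<le> k" by simp
  have fB: "f i \<in> B" if "i \<le> k" for i
  proof (cases "i < k")
    case True
    then show ?thesis using f(2)[of i] by (auto simp: R_def)
  next
    case False
    then have "i = k" using that by simp
    then show ?thesis using f(1) by (auto simp: N_def)
  qed
  have ne: "f i \<noteq> f j" if "i < j" "j \<le> k" for i j
    using shortcut[of i j 0] that by auto
  then have inj: "inj_on f {..<Suc k}"
    by (intro linorder_inj_onI) auto
  have chordless: "f i \<bullet> f j = 0" if "Suc i < j" "j \<le> k" "(i, j) \<noteq> (0, k)" for i j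
  proof (rule ccontr)
    assume "f i \<bullet> f j \<noteq> 0"
    moreover have "f i \<in> B" "f j \<in> B" using fB that by simp_all
    ultimately consider "(f i, f j) \<in> R" | "(f i, f j) \<in> N"
      using cases by blast
    then show False
    proof cases
      case 1
      moreover have "1 < j - i" using that by linarith
      ultimately show False using shortcut[of i j 1] that by simp
    next
      \<comment> \<open>A sign-reversing chord would itself be a pair in N joined by a strictly
        shorter segment.\<close>
      case 2
      have "(f i, f j) \<in> R ^^ (j - i)" using seg[of i "j - i"] that by simp
      then have "P (j - i)" using 2 unfolding P_def by blast
      moreover have "j - i < k" using that by auto
      ultimately show False using minimal by blast
    qed
  qed
  have "gram_det (Suc k) f \<noteq> gram_det (Suc k) (\<Phi> \<circ> f)"
  proof (rule gram_det_flip_corner[OF k])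
    fix i j assume ij: "i \<le> j" "j \<le> k" "(i, j) \<noteq> (0, k)"
    consider "i = j" | "j = Suc i" | "Suc i < j" using ij(1) by linarith
    then show "(\<Phi> \<circ> f) i \<bullet> (\<Phi> \<circ> f) j = f i \<bullet> f j"
    proof cases
      case 1 then show ?thesis using norm_eq fB ij by simp
    next
      case 2 then show ?thesis using f(2)[of i] ij by (auto simp: R_def)
    next
      \<comment> \<open>Chords vanish before \<Phi>, hence also after it, because absolute values
        are preserved.\<close>
      case 3 then show ?thesis using chordless[of i j] abs_eq[of "f i" "f j"] fB ij by simp
    qed
  qed (use f chordless in \<open>auto simp: R_def N_def\<close>)
  moreover have "gram_det (Suc k) f = gram_det (Suc k) (\<Phi> \<circ> f)"
    using inj fB by (intro gram) auto
  ultimately show False by simp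
qed

theorem theorem6p12:
  fixes B :: "'a::{real_inner, complete_space} set"
    and \<Phi> :: "'a \<Rightarrow> 'a"
  assumes "B \<subseteq> UNIV - {0}"
    and "connectedin weak_topology B"
    and "closure (span B) = UNIV"
    and "continuous_map (subtopology weak_topology B) weak_topology \<Phi>"
    and "\<And>(n::nat) (v :: nat \<Rightarrow> 'a).
           inj_on v {..<n} \<Longrightarrow> v ` {..<n} \<subseteq> B \<Longrightarrow>
           parallelepiped_volume n v = parallelepiped_volume n (\<Phi> \<circ> v)"
  shows "\<exists>T. linear_isometry T \<and> (\<forall>x\<in>B. T x = \<Phi> x)"
proof (rule inner_preserving_extends_to_isometry[OF assms(3)])
  have gram: "gram_det n v = gram_det n (\<Phi> \<circ> v)" if "0 < n" "inj_on v {..<n}" "v ` {..<n} \<subseteq> B" for n v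
    using that assms(5) by (intro gram_det_eq_of_volume_eq)
  \<comment> \<open>One-element families give preservation of norms; two-element families then give
    inner products up to sign.\<close>
  have norm_eq: "\<Phi> x \<bullet> \<Phi> x = x \<bullet> x" if "x \<in> B" for x
    using gram[of 1 "\<lambda>_. x"] that by (simp add: gram_det_1[unfolded One_nat_def] inj_on_def image_subset_iff)
  have abs_eq: "\<bar>\<Phi> x \<bullet> \<Phi> y\<bar> = \<bar>x \<bullet> y\<bar>" if "x \<in> B" "y \<in> B" for x y
  proof (cases "x = y")
    case False
    define v where "v i = (if i = (0::nat) then x else y)" for i
    have "gram_det 2 v = gram_det 2 (\<Phi> \<circ> v)"
      using False that by (intro gram) (auto simp: v_def inj_on_def less_2_cases_iff)
    then have "(\<Phi> x \<bullet> \<Phi> y)\<^sup>2 = (x \<bullet> y)\<^sup>2"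
      using that by (simp add: gram_det_2 v_def norm_eq)
    then show ?thesis by (simp add: power2_eq_iff abs_eq_iff)
  qed (use norm_eq that in simp)
  define R where "R = {(x, y) \<in> B \<times> B. x \<bullet> y \<noteq> 0 \<and> \<Phi> x \<bullet> \<Phi> y = x \<bullet> y}"
  have nbhd: "\<exists>U. openin (subtopology weak_topology B) U \<and> x \<in> U \<and> (\<forall>y\<in>U. (x, y) \<in> R)" if x: "x \<in> B" for x
  proof -
    let ?S = "subtopology weak_topology B"
    \<comment> \<open>On U both inner products with x and with \<Phi> x are positive, so equality up
      to sign becomes equality. The first condition is weakly open, the second is so by continuity
      of \<Phi>, and x itself satisfies both because it is nonzero.\<close>
    define U where "U = {y \<in> topspace ?S. y \<in> {y. 0 < x \<bullet> y}} \<inter> {y \<in> topspace ?S. \<Phi> y \<in> {z. 0 < \<Phi> x \<bullet> z}}"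
    have "openin ?S {y \<in> topspace ?S. y \<in> {y. 0 < x \<bullet> y}}"
      using openin_weak_topology_inner_pos[of x] unfolding openin_subtopology by auto
    moreover have "openin ?S {y \<in> topspace ?S. \<Phi> y \<in> {z. 0 < \<Phi> x \<bullet> z}}"
      using assms(4) openin_weak_topology_inner_pos by (rule openin_continuous_map_preimage)
    ultimately have "openin ?S U" unfolding U_def by (rule openin_Int)
    moreover have "x \<in> U"
      using x assms(1) norm_eq[OF x] by (auto simp: U_def)
    moreover have "(x, y) \<in> R" if "y \<in> U" for y
      using that x abs_eq[OF x, of y] by (auto simp: U_def R_def)
    ultimately show ?thesis by blast
  qed
  have "sym R" by (auto simp: sym_def R_def inner_commute)
  then have reach: "(x, y) \<in> R\<^sup>*" if "x \<in> B" "y \<in> B" for x y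
    using connectedin_rtrancl[OF assms(2) _ nbhd] that by blast
  show "\<Phi> x \<bullet> \<Phi> y = x \<bullet> y" if "x \<in> B" "y \<in> B" for x y
    using inner_eq_of_gram_det_eq[of B \<Phi> x y, OF gram reach[unfolded R_def]] norm_eq abs_eq assms(1) that by blast
qed

end
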